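(* Let $\mathbf p=(\mathbf p_1,\dots,\mathbf p_N)$ and $\mathbf q=(\mathbf q_1,\dots,\mathbf q_N)$ be two configurations of $N$ points in $\mathbb E^n$ such that $\mathbf q$ is a piecewise-smooth expansion of $\mathbf p$ in $\mathbb E^{n+2}$ (where $\mathbb E^n$ is regarded as the subset $\mathbb E^n\times\{\mathbf 0\}\subset\mathbb E^n\times\mathbb E^2=\mathbb E^{n+2}$). Then for all radii $r_1,\dots,r_N\ge 0$, $$\mathrm{Vol}_n\Big[\bigcup_{i=1}^N B(\mathbf p_i,r_i)\Big]\le \mathrm{Vol}_n\Big[\bigcup_{i=1}^N B(\mathbf q_i,r_i)\Big]$$ and $$\mathrm{Vol}_n\Big[\bigcap_{i=1}^N B(\mathbf p_i,r_i)\Big]\ge \mathrm{Vol}_n\Big[\bigcap_{i=1}^N B(\mathbf q_i,r_i)\Big],$$ where the balls are taken in $\mathbb E^n$.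
   Context: $\mathbb E^n$ is $n$-dimensional Euclidean space with norm $|\cdot|$; $B(\mathbf x,r)$ is the closed ball of radius $r\ge 0$ about $\mathbf x$ in $\mathbb E^n$; $\mathrm{Vol}_n$ is $n$-dimensional volume. A configuration is a finite tuple of points (not required to be distinct). A configuration $\mathbf q$ is a continuous expansion of $\mathbf p$ in $\mathbb E^m$ if there is a continuous motion $\mathbf p(t)=(\mathbf p_1(t),\dots,\mathbf p_N(t))$, $0\le t\le 1$, of points in $\mathbb E^m$ with $\mathbf p(0)=\mathbf p$, $\mathbf p(1)=\mathbf q$, such that for all $i<j$ the distance $|\mathbf p_i(t)-\mathbf p_j(t)|$ is monotone increasing (i.e. non-decreasing; constant functions are allowed) in $t$. It is a piecewise-smooth expansion in $\mathbb E^m$ if such a motion exists for which all the coordinates of all the points $\mathbf p_i(t)$ are infinitely differentiable functions of $t$ except for a finite number of values of $t$. *)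

theory Defs
  imports "HOL-Analysis.Analysis"
begin

text \<open>
  A configuration of \<open>N\<close> points is a function on \<open>nat\<close>, of which only the values at the
  indices \<open>1, \<dots>, N\<close> matter; likewise only the values of a motion on \<open>{0..1}\<close> matter.
\<close>

definition expansion_motion ::
  "nat \<Rightarrow> (nat \<Rightarrow> 'a::euclidean_space) \<Rightarrow> (nat \<Rightarrow> 'a) \<Rightarrow> (nat \<Rightarrow> real \<Rightarrow> 'a) \<Rightarrow> bool" where
  "expansion_motion N p q P \<longleftrightarrow>
     (\<forall>i\<in>{1..N}. continuous_on {0..1} (P i) \<and> P i 0 = p i \<and> P i 1 = q i) \<and>
     (\<forall>i\<in>{1..N}. \<forall>j\<in>{1..N}. i < j \<longrightarrow> mono_on {0..1} (\<lambda>t. dist (P i t) (P j t)))"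

text \<open>
  Only meaningful for open \<open>U\<close>: then the iterated derivatives on \<open>U\<close> do not depend on the values
  of \<open>f\<close> outside \<open>U\<close>.
\<close>

definition infinitely_differentiable_on :: "(real \<Rightarrow> real) \<Rightarrow> real set \<Rightarrow> bool" where
  "infinitely_differentiable_on f U \<longleftrightarrow>
     (\<forall>k. \<forall>t\<in>U. ((deriv ^^ k) f) field_differentiable (at t))"

text \<open>
  The endpoints \<open>0\<close> and \<open>1\<close> may always be counted among the finitely many exceptional times
  in \<open>S\<close>, so smoothness is only required on an open set.
\<close>

definition piecewise_smooth_expansion ::
  "nat \<Rightarrow> (nat \<Rightarrow> 'a::euclidean_space) \<Rightarrow> (nat \<Rightarrow> 'a) \<Rightarrow> bool" where
  "piecewise_smooth_expansion N p q \<longleftrightarrow>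
     (\<exists>P. expansion_motion N p q P \<and>
       (\<exists>S. finite S \<and>
         (\<forall>i\<in>{1..N}. \<forall>b\<in>Basis.
            infinitely_differentiable_on (\<lambda>t. P i t \<bullet> b) ({0<..<1} - S))))"

end

theory Submission imports Defs begin

text \<open>
  Let \<open>u\<^sub>i(x) = |x - p\<^sub>i|\<^sup>2 - r\<^sub>i\<^sup>2\<close> and \<open>f = min\<^sub>i u\<^sub>i\<close>, so that the union of the balls is
  \<open>{f \<le> 0}\<close>. Replace \<open>f\<close> by the soft minimum \<open>F = - ln (\<Sum>\<^sub>i exp (- \<beta> u\<^sub>i)) / \<beta>\<close> with its weights
  \<open>w\<^sub>i\<close>. Along a smooth expansion, in any dimension and for a test function \<open>\<phi> \<ge> 0\<close>,
  the derivative of \<open>\<integral> \<phi>(F)\<close> is \<open>\<integral> (\<phi>'(F) + \<beta> \<phi>(F)) A\<close> with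
  \<open>A = \<Sum>\<^sub>i\<^sub>j w\<^sub>i w\<^sub>j (p\<^sub>i - p\<^sub>j) \<bullet> (p\<^sub>i' - p\<^sub>j') \<ge> 0\<close>. As \<open>\<beta>\<close> tends to infinity, \<open>A\<close> vanishes off the
  hyperplanes \<open>u\<^sub>i = u\<^sub>j\<close>, so the term with \<open>\<phi>'\<close> disappears and \<open>\<integral> \<phi>(f)\<close> is nondecreasing; hence so
  is the volume of every layer \<open>{0 < f < \<epsilon>}\<close>. For \<open>\<beta>\<close> tending to minus infinity one obtains the
  maximum instead of the minimum, i.e. the intersection of the balls, and the reversed inequality.

  In \<open>E\<^sup>n \<times> E\<^sup>2\<close> the layer \<open>{0 < f(x) + |y|\<^sup>2 < \<epsilon>}\<close> has as fibre over \<open>x\<close> an annulus of area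
  exactly \<open>\<pi> \<epsilon>\<close> if \<open>f(x) \<le> 0\<close>, and at most \<open>\<pi> \<epsilon>\<close> or empty otherwise. Dividing the volume of
  the layer by \<open>\<pi> \<epsilon>\<close> and letting \<open>\<epsilon>\<close> tend to \<open>0\<close> gives the volume of \<open>{f \<le> 0}\<close> in \<open>E\<^sup>n\<close>.
\<close>

subsection \<open>Soft extrema of power distances\<close>

text \<open>The power of the point \<open>x\<close> with respect to a sphere about \<open>c\<close>;
  \<open>\<rho>\<close> stands for the squared radius.\<close>

definition power_dist :: "'a::euclidean_space \<Rightarrow> real \<Rightarrow> 'a \<Rightarrow> real" where
  "power_dist c \<rho> x = (x - c) \<bullet> (x - c) - \<rho>"

definition partition_fun ::
  "'i set \<Rightarrow> real \<Rightarrow> ('i \<Rightarrow> 'a::euclidean_space) \<Rightarrow> ('i \<Rightarrow> real) \<Rightarrow> 'a \<Rightarrow> real" where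
  "partition_fun I \<beta> c \<rho> x = (\<Sum>j\<in>I. exp (- \<beta> * power_dist (c j) (\<rho> j) x))"

definition soft_weight ::
  "'i set \<Rightarrow> real \<Rightarrow> ('i \<Rightarrow> 'a::euclidean_space) \<Rightarrow> ('i \<Rightarrow> real) \<Rightarrow> 'i \<Rightarrow> 'a \<Rightarrow> real" where
  "soft_weight I \<beta> c \<rho> i x = exp (- \<beta> * power_dist (c i) (\<rho> i) x) / partition_fun I \<beta> c \<rho> x"

definition soft_power ::
  "'i set \<Rightarrow> real \<Rightarrow> ('i \<Rightarrow> 'a::euclidean_space) \<Rightarrow> ('i \<Rightarrow> real) \<Rightarrow> 'a \<Rightarrow> real" where
  "soft_power I \<beta> c \<rho> x = - ln (partition_fun I \<beta> c \<rho> x) / \<beta>"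

text \<open>The minimum of the power distances for \<open>\<sigma> = 1\<close> and their maximum for \<open>\<sigma> = -1\<close>.\<close>

definition ext_power ::
  "real \<Rightarrow> 'i set \<Rightarrow> ('i \<Rightarrow> 'a::euclidean_space) \<Rightarrow> ('i \<Rightarrow> real) \<Rightarrow> 'a \<Rightarrow> real" where
  "ext_power \<sigma> I c \<rho> x = \<sigma> * Min ((\<lambda>j. \<sigma> * power_dist (c j) (\<rho> j) x) ` I)"

lemma power_dist_shift: "power_dist c \<rho> (x + v) = power_dist (c - v) \<rho> x"
  by (simp add: power_dist_def algebra_simps)

lemma soft_weight_shift:
  "soft_weight I \<beta> c \<rho> i (x + v) = soft_weight I \<beta> (\<lambda>j. c j - v) \<rho> i x"
  by (simp add: soft_weight_def partition_fun_def power_dist_shift)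

lemma soft_power_shift: "soft_power I \<beta> c \<rho> (x + v) = soft_power I \<beta> (\<lambda>j. c j - v) \<rho> x"
  by (simp add: soft_power_def partition_fun_def power_dist_shift)

lemma continuous_on_power_dist:
  assumes "continuous_on A c" "continuous_on A x"
  shows "continuous_on A (\<lambda>s. power_dist (c s) \<rho> (x s))"
  unfolding power_dist_def by (intro continuous_intros assms)

context
  fixes I :: "'i set"
  assumes I: "finite I" "I \<noteq> {}"
begin

lemma partition_fun_pos: "partition_fun I \<beta> c \<rho> x > 0"
  unfolding partition_fun_def using I by (intro sum_pos) auto

lemma soft_weight_nonneg: "soft_weight I \<beta> c \<rho> i x \<ge> 0"
  using partition_fun_pos[of \<beta> c \<rho> x] by (simp add: soft_weight_def)

lemma sum_soft_weight: "(\<Sum>i\<in>I. soft_weight I \<beta> c \<rho> i x) = 1"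
  using partition_fun_pos[of \<beta> c \<rho> x]
  unfolding soft_weight_def sum_divide_distrib[symmetric]
  by (simp add: partition_fun_def)

lemma soft_weight_le_1:
  assumes "i \<in> I"
  shows "soft_weight I \<beta> c \<rho> i x \<le> 1"
  using member_le_sum[of i I "\<lambda>i. soft_weight I \<beta> c \<rho> i x"] assms I
  by (simp add: sum_soft_weight soft_weight_nonneg)

text \<open>A weight is at most the quotient of its exponential by any other summand of the
  partition function. Both weights are at most 1, so their product is below either of them and hence
  below the smaller of the two quotients. This decay removes pairs with unequal power distances as
  \<open>\<beta>\<close> grows in absolute value.\<close>

lemma soft_weight_mult_le:
  assumes "i \<in> I" "j \<in> I"
  shows "soft_weight I \<beta> c \<rho> i x * soft_weight I \<beta> c \<rho> j x
    \<le> exp (- \<bar>\<beta> * (power_dist (c i) (\<rho> i) x - power_dist (c j) (\<rho> j) x)\<bar>)"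
proof -
  have *: "soft_weight I \<beta> c \<rho> i x \<le> exp (\<beta> * (power_dist (c j) (\<rho> j) x - power_dist (c i) (\<rho> i) x))"
    if "i \<in> I" "j \<in> I" for i j
  proof -
    have "exp (- \<beta> * power_dist (c j) (\<rho> j) x) \<le> partition_fun I \<beta> c \<rho> x"
      unfolding partition_fun_def using I that
      by (intro member_le_sum[of j I "\<lambda>j. exp (- \<beta> * power_dist (c j) (\<rho> j) x)"]) auto
    then have "soft_weight I \<beta> c \<rho> i x
        \<le> exp (- \<beta> * power_dist (c i) (\<rho> i) x) / exp (- \<beta> * power_dist (c j) (\<rho> j) x)"
      unfolding soft_weight_def by (intro divide_left_mono) (auto simp: partition_fun_pos)
    also have "\<dots> = exp (\<beta> * (power_dist (c j) (\<rho> j) x - power_dist (c i) (\<rho> i) x))"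
      by (simp add: exp_diff[symmetric] algebra_simps)
    finally show ?thesis .
  qed
  note w = *[OF assms] *[OF assms(2,1)] soft_weight_le_1[OF assms(1), of \<beta> c \<rho> x]
    soft_weight_le_1[OF assms(2), of \<beta> c \<rho> x]
  have "soft_weight I \<beta> c \<rho> i x * soft_weight I \<beta> c \<rho> j x \<le> soft_weight I \<beta> c \<rho> i x"
    "soft_weight I \<beta> c \<rho> i x * soft_weight I \<beta> c \<rho> j x \<le> soft_weight I \<beta> c \<rho> j x"
    using w(3,4) soft_weight_nonneg by (auto intro!: mult_left_le mult_left_le_one_le)
  with w(1,2) show ?thesis by (auto simp: abs_if algebra_simps)
qed

text \<open>With \<open>m\<close> the minimum of the signed power distances, the partition function
  lies between its largest summand \<open>exp (- \<kappa> * m)\<close> and \<open>card I\<close>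
  times that summand. Taking logarithms yields a bound uniform in \<open>x\<close>.\<close>

lemma abs_soft_power_diff_ext_power_le:
  assumes "\<sigma> = 1 \<or> \<sigma> = -1" "\<kappa> > 0"
  shows "\<bar>soft_power I (\<sigma> * \<kappa>) c \<rho> x - ext_power \<sigma> I c \<rho> x\<bar> \<le> ln (card I) / \<kappa>"
proof -
  define m where "m = Min ((\<lambda>j. \<sigma> * power_dist (c j) (\<rho> j) x) ` I)"
  define Z where "Z = partition_fun I (\<sigma> * \<kappa>) c \<rho> x"
  have Z: "Z > 0" by (simp add: Z_def partition_fun_pos)
  have "m \<in> (\<lambda>j. \<sigma> * power_dist (c j) (\<rho> j) x) ` I"
    unfolding m_def using I by (intro Min_in) auto
  then obtain k where k: "k \<in> I" "m = \<sigma> * power_dist (c k) (\<rho> k) x" by auto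
  have m: "m \<le> \<sigma> * power_dist (c j) (\<rho> j) x" if "j \<in> I" for j
    unfolding m_def using I that by (intro Min_le) auto
  have "exp (- \<kappa> * m) \<le> Z"
    using member_le_sum[of k I "\<lambda>j. exp (- (\<sigma> * \<kappa>) * power_dist (c j) (\<rho> j) x)"] k I
    by (simp add: Z_def partition_fun_def algebra_simps)
  then have lo: "- \<kappa> * m \<le> ln Z" using Z by (simp add: ln_ge_iff)
  have "Z \<le> (\<Sum>j\<in>I. exp (- \<kappa> * m))"
    unfolding Z_def partition_fun_def using m assms(2)
    by (intro sum_mono) (auto simp: algebra_simps intro!: mult_left_mono)
  then have "Z \<le> card I * exp (- \<kappa> * m)" by simp
  then have "ln Z \<le> ln (card I * exp (- \<kappa> * m))" using Z by (subst ln_le_cancel_iff) auto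
  also have "\<dots> = ln (card I) - \<kappa> * m" using I by (subst ln_mult_pos) (auto simp: card_gt_0_iff)
  finally have hi: "ln Z \<le> ln (card I) - \<kappa> * m" .
  have "soft_power I (\<sigma> * \<kappa>) c \<rho> x - ext_power \<sigma> I c \<rho> x = - \<sigma> * ((ln Z + \<kappa> * m) / \<kappa>)"
    unfolding soft_power_def ext_power_def Z_def[symmetric] m_def[symmetric]
    using assms by (auto simp: field_simps)
  then have "\<bar>soft_power I (\<sigma> * \<kappa>) c \<rho> x - ext_power \<sigma> I c \<rho> x\<bar> = (ln Z + \<kappa> * m) / \<kappa>"
    using lo assms by (auto simp: abs_mult)
  also have "\<dots> \<le> ln (card I) / \<kappa>"
    using hi assms(2) by (intro divide_right_mono) auto
  finally show ?thesis .
qed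

lemma ext_power_attained:
  assumes "\<sigma> = 1 \<or> \<sigma> = -1"
  obtains j where "j \<in> I" "ext_power \<sigma> I c \<rho> x = power_dist (c j) (\<rho> j) x"
proof -
  have "Min ((\<lambda>j. \<sigma> * power_dist (c j) (\<rho> j) x) ` I) \<in> (\<lambda>j. \<sigma> * power_dist (c j) (\<rho> j) x) ` I"
    using I by (intro Min_in) auto
  then show ?thesis using assms that by (auto simp: ext_power_def)
qed

lemma continuous_on_partition_fun:
  assumes "\<And>j. j \<in> I \<Longrightarrow> continuous_on A (c j)" "continuous_on A x"
  shows "continuous_on A (\<lambda>s. partition_fun I \<beta> (\<lambda>j. c j s) \<rho> (x s))"
  unfolding partition_fun_def by (intro continuous_intros continuous_on_power_dist assms)

lemma continuous_on_soft_weight: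
  assumes "\<And>j. j \<in> I \<Longrightarrow> continuous_on A (c j)" "continuous_on A x" "i \<in> I"
  shows "continuous_on A (\<lambda>s. soft_weight I \<beta> (\<lambda>j. c j s) \<rho> i (x s))"
  unfolding soft_weight_def
  by (intro continuous_intros continuous_on_power_dist continuous_on_partition_fun ballI
        partition_fun_pos[THEN less_imp_neq, symmetric] assms)

lemma continuous_on_soft_power:
  assumes "\<And>j. j \<in> I \<Longrightarrow> continuous_on A (c j)" "continuous_on A x"
  shows "continuous_on A (\<lambda>s. soft_power I \<beta> (\<lambda>j. c j s) \<rho> (x s))"
  unfolding soft_power_def divide_inverse
  by (intro continuous_intros continuous_on_partition_fun ballI
        partition_fun_pos[THEN less_imp_neq, symmetric] assms)

lemma continuous_on_Min_image:
  fixes f :: "'i \<Rightarrow> 'b::topological_space \<Rightarrow> real"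
  assumes "\<And>j. j \<in> I \<Longrightarrow> continuous_on A (f j)"
  shows "continuous_on A (\<lambda>s. Min ((\<lambda>j. f j s) ` I))"
  using I assms
proof (induction rule: finite_ne_induct)
  case (insert j J)
  have "(\<lambda>s. Min ((\<lambda>j. f j s) ` insert j J)) = (\<lambda>s. min (f j s) (Min ((\<lambda>j. f j s) ` J)))"
    using insert.hyps by (intro ext) (simp add: Min_insert)
  with insert show ?case by (auto intro!: continuous_intros)
qed auto

lemma continuous_on_ext_power:
  assumes "\<And>j. j \<in> I \<Longrightarrow> continuous_on A (c j)" "continuous_on A x"
  shows "continuous_on A (\<lambda>s. ext_power \<sigma> I (\<lambda>j. c j s) \<rho> (x s))"
  unfolding ext_power_def
  by (intro continuous_intros continuous_on_Min_image continuous_on_power_dist assms)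

lemma has_derivative_partition_fun:
  assumes "\<And>j. j \<in> I \<Longrightarrow> (c j has_vector_derivative v j) (at t within T)"
  shows "((\<lambda>t. partition_fun I \<beta> (\<lambda>j. c j t) \<rho> x) has_real_derivative
     (\<Sum>j\<in>I. exp (- \<beta> * power_dist (c j t) (\<rho> j) x) * (2 * \<beta> * ((x - c j t) \<bullet> v j)))) (at t within T)"
proof -
  have "((\<lambda>t. power_dist (c j t) (\<rho> j) x) has_real_derivative (- 2 * ((x - c j t) \<bullet> v j)))
      (at t within T)" if "j \<in> I" for j
    unfolding power_dist_def has_real_derivative_iff_has_vector_derivative
    using assms[OF that]
    by (auto intro!: derivative_eq_intros simp: inner_commute has_vector_derivative_def algebra_simps)
  then show ?thesis
    unfolding partition_fun_def
    by (auto intro!: derivative_eq_intros sum.cong simp: algebra_simps)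
qed

lemma has_derivative_soft_power:
  assumes "\<And>j. j \<in> I \<Longrightarrow> (c j has_vector_derivative v j) (at t within T)" "\<beta> \<noteq> 0"
  shows "((\<lambda>t. soft_power I \<beta> (\<lambda>j. c j t) \<rho> x) has_real_derivative
     - (\<Sum>j\<in>I. soft_weight I \<beta> (\<lambda>j. c j t) \<rho> j x * (2 * ((x - c j t) \<bullet> v j)))) (at t within T)"
proof -
  let ?Z = "partition_fun I \<beta> (\<lambda>j. c j t) \<rho> x"
  have "((\<lambda>t. partition_fun I \<beta> (\<lambda>j. c j t) \<rho> x) has_real_derivative
     (\<Sum>j\<in>I. exp (- \<beta> * power_dist (c j t) (\<rho> j) x) * (2 * \<beta> * ((x - c j t) \<bullet> v j)))) (at t within T)"
    by (rule has_derivative_partition_fun) (rule assms(1))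
  note D = DERIV_cdivide[OF DERIV_minus[OF DERIV_chain2[OF DERIV_ln_divide[OF partition_fun_pos] this]],
      of \<beta>]
  have "- (1 / ?Z * (\<Sum>j\<in>I. exp (- \<beta> * power_dist (c j t) (\<rho> j) x) * (2 * \<beta> * ((x - c j t) \<bullet> v j)))) / \<beta>
      = - (\<Sum>j\<in>I. soft_weight I \<beta> (\<lambda>j. c j t) \<rho> j x * (2 * ((x - c j t) \<bullet> v j)))"
    unfolding soft_weight_def sum_distrib_left sum_negf[symmetric] sum_divide_distrib
    using assms(2) by (intro sum.cong) auto
  with D show ?thesis unfolding soft_power_def by simp
qed

text \<open>This is the situation seen from the \<open>i\<close>-th centre, which is then at rest:
  the numerator of its weight is constant in time and only the partition function varies.\<close>

lemma has_derivative_soft_weight_fixed: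
  assumes "\<And>j. j \<in> I \<Longrightarrow> (c j has_vector_derivative v j) (at t within T)" "\<And>t. c i t = d"
  shows "((\<lambda>t. soft_weight I \<beta> (\<lambda>j. c j t) \<rho> i x) has_real_derivative
     - \<beta> * soft_weight I \<beta> (\<lambda>j. c j t) \<rho> i x *
       (\<Sum>j\<in>I. soft_weight I \<beta> (\<lambda>j. c j t) \<rho> j x * (2 * ((x - c j t) \<bullet> v j)))) (at t within T)"
proof -
  let ?Z = "partition_fun I \<beta> (\<lambda>j. c j t) \<rho> x" and ?e = "exp (- \<beta> * power_dist d (\<rho> i) x)"
    and ?S = "\<Sum>j\<in>I. exp (- \<beta> * power_dist (c j t) (\<rho> j) x) * (2 * \<beta> * ((x - c j t) \<bullet> v j))"
  have Z: "?Z \<noteq> 0" using partition_fun_pos[of \<beta> "\<lambda>j. c j t" \<rho> x] by simp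
  have "((\<lambda>t. partition_fun I \<beta> (\<lambda>j. c j t) \<rho> x) has_real_derivative ?S) (at t within T)"
    by (rule has_derivative_partition_fun) (rule assms(1))
  note D = DERIV_divide[OF DERIV_const[of ?e] this Z]
  have S: "?S = \<beta> * (\<Sum>j\<in>I. soft_weight I \<beta> (\<lambda>j. c j t) \<rho> j x * (2 * ((x - c j t) \<bullet> v j))) * ?Z"
    unfolding soft_weight_def sum_distrib_left sum_distrib_right
    using Z by (intro sum.cong) auto
  have "(0 * ?Z - ?e * ?S) / (?Z * ?Z) = - \<beta> * (?e / ?Z) *
       (\<Sum>j\<in>I. soft_weight I \<beta> (\<lambda>j. c j t) \<rho> j x * (2 * ((x - c j t) \<bullet> v j)))"
    unfolding S using Z by (simp add: field_simps)
  with D show ?thesis unfolding soft_weight_def[of I \<beta> _ \<rho> i] assms(2) by simp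
qed

end

subsection \<open>Monotonicity along a smooth piece of the motion\<close>

text \<open>The box contains the support of \<open>f\<close> and that of its translate, so both
  sides are integrals over the whole space and translation invariance applies.\<close>

lemma integral_cbox_shift_support:
  fixes f :: "'a::euclidean_space \<Rightarrow> real"
  assumes "\<And>x. f x \<noteq> 0 \<Longrightarrow> x \<in> cbox a b" "\<And>x. f x \<noteq> 0 \<Longrightarrow> x - c \<in> cbox a b"
  shows "integral (cbox a b) (\<lambda>x. f (x + c)) = integral (cbox a b) f"
proof -
  have mem: "x \<in> cbox (a + c) (b + c)" if "x - c \<in> cbox a b" for x
    using that by (auto simp: mem_box inner_diff_left inner_add_left algebra_simps)
  have "integral (cbox a b) (\<lambda>x. f (x + c)) = integral (cbox (a + c) (b + c)) f"
    using integral_shift_cbox[of "a + c" c "b + c" f] by simp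
  also have "\<dots> = integral UNIV (\<lambda>x. if x \<in> cbox (a + c) (b + c) then f x else 0)"
    by (rule integral_restrict_UNIV[symmetric])
  also have "(\<lambda>x. if x \<in> cbox (a + c) (b + c) then f x else 0) = (\<lambda>x. if x \<in> cbox a b then f x else 0)"
    using assms mem by (intro ext) metis
  also have "integral UNIV \<dots> = integral (cbox a b) f"
    by (rule integral_restrict_UNIV)
  finally show ?thesis .
qed

lemma norm_le_imp_mem_cbox_One:
  fixes x :: "'a::euclidean_space"
  assumes "norm x \<le> R"
  shows "x \<in> cbox (- (R *\<^sub>R One)) (R *\<^sub>R One)"
  unfolding mem_box
proof
  fix i :: 'a assume "i \<in> Basis"
  with Basis_le_norm[OF this, of x] assms
  show "- (R *\<^sub>R One) \<bullet> i \<le> x \<bullet> i \<and> x \<bullet> i \<le> R *\<^sub>R One \<bullet> i"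
    by (auto simp: abs_le_iff)
qed

section \<open>Test functions and the data of a smooth piece\<close>

text \<open>Power distances grow with \<open>x\<close>, so vanishing from \<open>M\<close> on
  confines the integrands to a bounded region. The common bound \<open>K\<close> serves dominated
  convergence.\<close>

locale test_function =
  fixes \<phi> \<phi>' :: "real \<Rightarrow> real" and M K :: real
  assumes deriv_\<phi>: "(\<phi> has_real_derivative \<phi>' u) (at u)"
    and cont_\<phi>': "continuous_on UNIV \<phi>'"
    and \<phi>_nonneg: "\<phi> u \<ge> 0"
    and \<phi>_le: "\<phi> u \<le> K"
    and \<phi>'_le: "\<bar>\<phi>' u\<bar> \<le> K"
    and \<phi>_eq_0: "u \<ge> M \<Longrightarrow> \<phi> u = 0"
    and \<phi>'_eq_0: "u \<ge> M \<Longrightarrow> \<phi>' u = 0"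
begin

lemma cont_\<phi>: "continuous_on UNIV \<phi>"
  using deriv_\<phi> DERIV_isCont by (intro continuous_at_imp_continuous_on) blast

lemmas continuous_on_\<phi> [continuous_intros] = continuous_on_compose2[OF cont_\<phi> _ subset_UNIV]
  and continuous_on_\<phi>' [continuous_intros] = continuous_on_compose2[OF cont_\<phi>' _ subset_UNIV]

end

text \<open>The summand \<open>card I\<close> in the condition on \<open>R\<close> absorbs the gap
  between soft and true extremum for every \<open>\<kappa> \<ge> 1\<close>, so that one
  \<open>R\<close> serves all \<open>\<kappa>\<close>.\<close>

locale smooth_piece = test_function +
  fixes I :: "'i set" and P V :: "'i \<Rightarrow> real \<Rightarrow> 'a::euclidean_space" and \<rho> :: "'i \<Rightarrow> real"
    and a b \<sigma> B R :: real
  assumes I: "finite I" "I \<noteq> {}"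
    and ab: "a \<le> b"
    and \<sigma>: "\<sigma> = 1 \<or> \<sigma> = -1"
    and deriv_P: "\<lbrakk>i \<in> I; t \<in> {a..b}\<rbrakk> \<Longrightarrow> (P i has_vector_derivative V i t) (at t within {a..b})"
    and cont_V: "i \<in> I \<Longrightarrow> continuous_on {a..b} (V i)"
    and expanding: "\<lbrakk>i \<in> I; j \<in> I; t \<in> {a..b}\<rbrakk> \<Longrightarrow> (P i t - P j t) \<bullet> (V i t - V j t) \<ge> 0"
    and norm_P: "\<lbrakk>i \<in> I; t \<in> {a..b}\<rbrakk> \<Longrightarrow> norm (P i t) \<le> B"
    and R: "R \<ge> 0" "\<And>i. i \<in> I \<Longrightarrow> M + card I + \<rho> i \<le> R\<^sup>2"
begin

text \<open>The supports lie within norm \<open>R + B\<close>; the second \<open>B\<close> leaves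
  room for shifting them by a centre.\<close>

abbreviation X :: "'a set" where "X \<equiv> cbox (- ((R + 2 * B) *\<^sub>R One)) ((R + 2 * B) *\<^sub>R One)"

abbreviation F where "F \<beta> t \<equiv> soft_power I \<beta> (\<lambda>j. P j t) \<rho>"
abbreviation W where "W \<beta> t \<equiv> soft_weight I \<beta> (\<lambda>j. P j t) \<rho>"
abbreviation E where "E t \<equiv> ext_power \<sigma> I (\<lambda>j. P j t) \<rho>"

text \<open>Each inner product is half the rate of change of a squared distance between two centres,
  and the products of weights sum to 1: a mean rate of expansion as seen from
  \<open>x\<close>.\<close>

definition A where
  "A \<beta> t x = (\<Sum>i\<in>I. \<Sum>j\<in>I. W \<beta> t i x * W \<beta> t j x * ((P i t - P j t) \<bullet> (V i t - V j t)))"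

lemma B_nonneg: "B \<ge> 0"
  using I ab norm_P[of "SOME i. i \<in> I" a] norm_ge_zero order_trans some_in_eq[of I]
  by (metis atLeastAtMost_iff order_refl)

lemma cont_P: "i \<in> I \<Longrightarrow> continuous_on {a..b} (P i)"
  using deriv_P by (meson continuous_on_eq_continuous_within has_vector_derivative_continuous)

lemma abs_F_diff_E_le:
  assumes "\<kappa> \<ge> 1"
  shows "\<bar>F (\<sigma> * \<kappa>) t x - E t x\<bar> \<le> card I / \<kappa>"
proof -
  have "\<bar>F (\<sigma> * \<kappa>) t x - E t x\<bar> \<le> ln (card I) / \<kappa>"
    using assms by (intro abs_soft_power_diff_ext_power_le I \<sigma>) simp
  also have "\<dots> \<le> card I / \<kappa>"
    using assms I by (intro divide_right_mono less_imp_le[OF ln_less_self]) (simp_all add: card_gt_0_iff)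
  finally show ?thesis .
qed

text \<open>The true extremum exceeds \<open>F\<close> by at most \<open>card I\<close> and equals
  one of the power distances, so \<open>x\<close> lies within \<open>R\<close> of some
  centre.\<close>

lemma support_F:
  assumes "\<kappa> \<ge> 1" "t \<in> {a..b}" "F (\<sigma> * \<kappa>) t x < M"
  shows "norm x \<le> R + B"
proof -
  obtain j where j: "j \<in> I" "E t x = power_dist (P j t) (\<rho> j) x"
    using ext_power_attained[OF I \<sigma>] by blast
  have "card I / \<kappa> \<le> card I" using assms(1) by (simp add: divide_le_eq mult_le_cancel_left1)
  with abs_F_diff_E_le[OF assms(1), of t x] assms(3) j
  have "power_dist (P j t) (\<rho> j) x < M + card I" by linarith
  then have "(norm (x - P j t))\<^sup>2 \<le> R\<^sup>2"
    using R(2)[OF j(1)] by (simp add: power_dist_def power2_norm_eq_inner)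
  then have "norm (x - P j t) \<le> R" using R(1) by (simp add: abs_le_square_iff[symmetric])
  with norm_P[OF j(1) assms(2)] norm_triangle_ineq2[of x "P j t"] show ?thesis by linarith
qed

lemma support_shift:
  assumes "\<kappa> \<ge> 1" "t \<in> {a..b}" "i \<in> I" "F (\<sigma> * \<kappa>) t x < M"
  shows "x \<in> X" "x - P i t \<in> X"
  using support_F[OF assms(1,2,4)] norm_P[OF assms(3,2)] B_nonneg norm_triangle_ineq4[of x "P i t"]
  by (auto intro!: norm_le_imp_mem_cbox_One)

lemma continuous_on_F:
  assumes "continuous_on S \<tau>" "\<tau> ` S \<subseteq> {a..b}" "continuous_on S y"
  shows "continuous_on S (\<lambda>s. F \<beta> (\<tau> s) (y s))"
  by (intro continuous_on_soft_power I assms continuous_on_compose2[OF cont_P assms(1,2)])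

lemma continuous_on_W:
  assumes "continuous_on S \<tau>" "\<tau> ` S \<subseteq> {a..b}" "continuous_on S y" "i \<in> I"
  shows "continuous_on S (\<lambda>s. W \<beta> (\<tau> s) i (y s))"
  by (intro continuous_on_soft_weight I assms continuous_on_compose2[OF cont_P assms(1,2)])

lemma continuous_on_A:
  assumes "continuous_on S \<tau>" "\<tau> ` S \<subseteq> {a..b}" "continuous_on S y"
  shows "continuous_on S (\<lambda>s. A \<beta> (\<tau> s) (y s))"
  unfolding A_def
  by (intro continuous_intros continuous_on_W assms continuous_on_compose2[OF cont_P assms(1,2)]
      continuous_on_compose2[OF cont_V assms(1,2)])

lemma A_nonneg: "t \<in> {a..b} \<Longrightarrow> A \<beta> t x \<ge> 0"
  unfolding A_def by (intro sum_nonneg mult_nonneg_nonneg soft_weight_nonneg I expanding)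

text \<open>
  The chain rule produces the left-hand side; exchanging the roles of \<open>i\<close> and \<open>j\<close> removes the
  dependence on the base point \<open>y\<close>.
\<close>

lemma A_symmetrised:
  "(\<Sum>i\<in>I. W \<beta> t i y * (\<Sum>j\<in>I. W \<beta> t j y * (2 * ((y - P j t) \<bullet> (V i t - V j t))))) = A \<beta> t y"
  (is "?L = _")
proof -
  let ?g = "\<lambda>i j. W \<beta> t i y * (W \<beta> t j y * (2 * ((y - P j t) \<bullet> (V i t - V j t))))"
  have L: "?L = (\<Sum>i\<in>I. \<Sum>j\<in>I. ?g i j)" by (simp add: sum_distrib_left)
  moreover have "(\<Sum>i\<in>I. \<Sum>j\<in>I. ?g i j) = (\<Sum>i\<in>I. \<Sum>j\<in>I. ?g j i)" by (rule sum.swap)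
  ultimately have "2 * ?L = (\<Sum>i\<in>I. \<Sum>j\<in>I. ?g i j + ?g j i)" by (simp add: sum.distrib)
  also have "\<dots> = (\<Sum>i\<in>I. \<Sum>j\<in>I. 2 * (W \<beta> t i y * W \<beta> t j y * ((P i t - P j t) \<bullet> (V i t - V j t))))"
    by (intro sum.cong refl) (simp add: inner_diff_left inner_diff_right algebra_simps)
  also have "\<dots> = 2 * A \<beta> t y" by (simp add: A_def sum_distrib_left)
  finally show ?thesis by simp
qed

section \<open>Time derivative of the smoothed integral\<close>

definition H where "H \<beta> t = integral X (\<lambda>x. \<phi> (F \<beta> t x))"

text \<open>
  Splitting \<open>\<phi> (F \<beta> t x)\<close> with the weights and moving the \<open>i\<close>-th summand along with the \<open>i\<close>-th
  centre replaces the integration by parts in the classical derivation of the volume formula.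
\<close>

definition G where
  "G \<beta> i t x = W \<beta> t i (x + P i t) * \<phi> (F \<beta> t (x + P i t))"

text \<open>The time derivative of \<open>G\<close> written in fixed coordinates: at the point
  \<open>x\<close> of the moving frame it is evaluated at \<open>x + P i t\<close>.\<close>

definition dG where
  "dG \<beta> i t x = (\<phi>' (F \<beta> t x) + \<beta> * \<phi> (F \<beta> t x)) *
     (W \<beta> t i x * (\<Sum>j\<in>I. W \<beta> t j x * (2 * ((x - P j t) \<bullet> (V i t - V j t)))))"

lemma integrable_cont_X: "continuous_on X f \<Longrightarrow> f integrable_on X" for f :: "'a \<Rightarrow> real"
  by (rule integrable_continuous)

text \<open>Undoing the translation in each summand leaves the weights at a common point, where they
  sum to 1.\<close>

lemma sum_integral_G:
  assumes "\<kappa> \<ge> 1" "t \<in> {a..b}"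
  shows "(\<Sum>i\<in>I. integral X (G (\<sigma> * \<kappa>) i t)) = H (\<sigma> * \<kappa>) t"
proof -
  let ?\<beta> = "\<sigma> * \<kappa>"
  let ?f = "\<lambda>i x. W ?\<beta> t i x * \<phi> (F ?\<beta> t x)"
  have "(\<Sum>i\<in>I. integral X (G ?\<beta> i t)) = (\<Sum>i\<in>I. integral X (?f i))"
    unfolding G_def
  proof (intro sum.cong refl integral_cbox_shift_support)
    fix i x assume "i \<in> I" "?f i x \<noteq> 0"
    then have "F ?\<beta> t x < M" using \<phi>_eq_0[of "F ?\<beta> t x"] by (cases "F ?\<beta> t x < M") auto
    then show "x \<in> X" "x - P i t \<in> X" using support_shift assms \<open>i \<in> I\<close> by blast+
  qed
  also have "\<dots> = integral X (\<lambda>x. \<Sum>i\<in>I. ?f i x)"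
    using I assms
    by (intro integral_sum[symmetric] integrable_cont_X continuous_intros continuous_on_F
        continuous_on_W) auto
  also have "\<dots> = H ?\<beta> t"
    unfolding H_def by (simp add: sum_distrib_right[symmetric] sum_soft_weight[OF I])
  finally show ?thesis .
qed

text \<open>After translating back, the sum over \<open>i\<close> can be taken under the integral
  and symmetrised.\<close>

lemma sum_integral_dG:
  assumes "\<kappa> \<ge> 1" "t \<in> {a..b}"
  shows "(\<Sum>i\<in>I. integral X (\<lambda>x. dG (\<sigma> * \<kappa>) i t (x + P i t)))
    = integral X (\<lambda>x. (\<phi>' (F (\<sigma> * \<kappa>) t x) + (\<sigma> * \<kappa>) * \<phi> (F (\<sigma> * \<kappa>) t x)) * A (\<sigma> * \<kappa>) t x)"
proof -
  let ?\<beta> = "\<sigma> * \<kappa>"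
  have "(\<Sum>i\<in>I. integral X (\<lambda>x. dG ?\<beta> i t (x + P i t))) = (\<Sum>i\<in>I. integral X (dG ?\<beta> i t))"
  proof (intro sum.cong refl integral_cbox_shift_support)
    fix i x assume "i \<in> I" "dG ?\<beta> i t x \<noteq> 0"
    then have "F ?\<beta> t x < M" using \<phi>_eq_0[of "F ?\<beta> t x"] \<phi>'_eq_0[of "F ?\<beta> t x"]
      by (cases "F ?\<beta> t x < M") (auto simp: dG_def)
    then show "x \<in> X" "x - P i t \<in> X" using support_shift assms \<open>i \<in> I\<close> by blast+
  qed
  also have "\<dots> = integral X (\<lambda>x. \<Sum>i\<in>I. dG ?\<beta> i t x)"
    using I assms unfolding dG_def
    by (intro integral_sum[symmetric] integrable_cont_X continuous_intros continuous_on_F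
        continuous_on_W) auto
  also have "\<dots> = integral X (\<lambda>x. (\<phi>' (F ?\<beta> t x) + ?\<beta> * \<phi> (F ?\<beta> t x)) * A ?\<beta> t x)"
    unfolding dG_def sum_distrib_left[symmetric] A_symmetrised ..
  finally show ?thesis .
qed

text \<open>Relative to \<open>P i t\<close> the centres move with velocities
  \<open>V j t - V i t\<close> and the \<open>i\<close>-th one rests. The soft extremum then has
  derivative \<open>- ?S\<close> and the weight \<open>- \<beta>\<close> times itself times
  \<open>?S\<close>, so the product rule yields the common factor
  \<open>\<phi>' + \<beta> * \<phi>\<close>.\<close>

lemma has_derivative_G:
  assumes "\<beta> \<noteq> 0" "i \<in> I" "t \<in> {a..b}"
  shows "((\<lambda>t. G \<beta> i t x) has_vector_derivative dG \<beta> i t (x + P i t)) (at t within {a..b})"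
proof -
  have dP: "((\<lambda>t. P j t - P i t) has_vector_derivative (V j t - V i t)) (at t within {a..b})"
    if "j \<in> I" for j
    using that assms by (intro derivative_intros deriv_P)
  let ?S = "\<Sum>j\<in>I. soft_weight I \<beta> (\<lambda>j. P j t - P i t) \<rho> j x *
    (2 * ((x - (P j t - P i t)) \<bullet> (V j t - V i t)))"
  have S: "?S = - (\<Sum>j\<in>I. W \<beta> t j (x + P i t) * (2 * ((x + P i t - P j t) \<bullet> (V i t - V j t))))"
    unfolding soft_weight_shift sum_negf[symmetric]
    by (intro sum.cong refl) (simp add: inner_diff_right algebra_simps)
  have d1: "((\<lambda>t. soft_power I \<beta> (\<lambda>j. P j t - P i t) \<rho> x) has_real_derivative - ?S) (at t within {a..b})"
    by (rule has_derivative_soft_power[OF I]) (use dP assms in auto)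
  have d2: "((\<lambda>t. soft_weight I \<beta> (\<lambda>j. P j t - P i t) \<rho> i x) has_real_derivative
      - \<beta> * soft_weight I \<beta> (\<lambda>j. P j t - P i t) \<rho> i x * ?S) (at t within {a..b})"
    by (rule has_derivative_soft_weight_fixed[OF I]) (use dP in auto)
  note d = DERIV_mult[OF d2 DERIV_chain2[OF deriv_\<phi> d1]]
  show ?thesis
    unfolding has_real_derivative_iff_has_vector_derivative[symmetric]
    by (rule DERIV_cong[OF d[unfolded S, folded soft_weight_shift soft_power_shift, folded G_def]])
      (simp add: dG_def algebra_simps)
qed

lemma has_derivative_H:
  assumes "\<kappa> \<ge> 1" "t \<in> {a..b}"
  shows "(H (\<sigma> * \<kappa>) has_vector_derivative
    integral X (\<lambda>x. (\<phi>' (F (\<sigma> * \<kappa>) t x) + (\<sigma> * \<kappa>) * \<phi> (F (\<sigma> * \<kappa>) t x)) * A (\<sigma> * \<kappa>) t x))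
    (at t within {a..b})"
proof -
  let ?\<beta> = "\<sigma> * \<kappa>"
  have \<beta>: "?\<beta> \<noteq> 0" using \<sigma> assms(1) by auto
  have "((\<lambda>t. integral X (G ?\<beta> i t)) has_vector_derivative integral X (\<lambda>x. dG ?\<beta> i t (x + P i t)))
      (at t within {a..b})" if i: "i \<in> I" for i
  proof (rule leibniz_rule_vector_derivative)
    show "G ?\<beta> i t integrable_on X" if "t \<in> {a..b}" for t
      unfolding G_def using i that
      by (intro integrable_cont_X continuous_intros continuous_on_F continuous_on_W) auto
    show "continuous_on ({a..b} \<times> X) (\<lambda>(t, x). dG ?\<beta> i t (x + P i t))"
      unfolding dG_def case_prod_beta using i
      by (intro continuous_intros continuous_on_F continuous_on_W
         continuous_on_compose2[OF cont_P continuous_on_fst] continuous_on_compose2[OF cont_V continuous_on_fst])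
        auto
  qed (use assms has_derivative_G[OF \<beta> i] in auto)
  then have "((\<lambda>t. \<Sum>i\<in>I. integral X (G ?\<beta> i t)) has_vector_derivative
      (\<Sum>i\<in>I. integral X (\<lambda>x. dG ?\<beta> i t (x + P i t)))) (at t within {a..b})"
    by (rule has_vector_derivative_sum)
  then show ?thesis
    unfolding sum_integral_dG[OF assms]
    by (rule has_vector_derivative_transform[rotated 2]) (use assms sum_integral_G in auto)
qed

section \<open>The error term and its limit\<close>

definition err where "err \<beta> t = integral X (\<lambda>x. \<bar>\<phi>' (F \<beta> t x)\<bar> * A \<beta> t x)"

lemma continuous_on_err: "continuous_on {a..b} (err \<beta>)"
  unfolding err_def
  by (rule integral_continuous_on_param)
    (auto simp: case_prod_beta intro!: continuous_intros continuous_on_F continuous_on_A)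

lemma H_diff_ge:
  assumes "\<kappa> \<ge> 1"
  shows "\<sigma> * (H (\<sigma> * \<kappa>) b - H (\<sigma> * \<kappa>) a) \<ge> - integral {a..b} (err (\<sigma> * \<kappa>))"
proof -
  let ?\<beta> = "\<sigma> * \<kappa>"
  let ?D = "\<lambda>t. integral X (\<lambda>x. (\<phi>' (F ?\<beta> t x) + ?\<beta> * \<phi> (F ?\<beta> t x)) * A ?\<beta> t x)"
  have "(?D has_integral (H ?\<beta> b - H ?\<beta> a)) {a..b}"
    using ab has_derivative_H[OF assms] by (intro fundamental_theorem_of_calculus) auto
  then have D: "((\<lambda>t. \<sigma> * ?D t) has_integral \<sigma> * (H ?\<beta> b - H ?\<beta> a)) {a..b}"
    by (rule has_integral_mult_right)
  have err: "((\<lambda>t. - err ?\<beta> t) has_integral - integral {a..b} (err ?\<beta>)) {a..b}"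
    by (intro has_integral_neg integrable_integral integrable_continuous_interval continuous_on_err)
  have le: "- err ?\<beta> t \<le> \<sigma> * ?D t" if t: "t \<in> {a..b}" for t
  proof -
    have "- err ?\<beta> t = integral X (\<lambda>x. - (\<bar>\<phi>' (F ?\<beta> t x)\<bar> * A ?\<beta> t x))"
      by (simp add: err_def)
    also have "\<dots> \<le> integral X (\<lambda>x. \<sigma> * ((\<phi>' (F ?\<beta> t x) + ?\<beta> * \<phi> (F ?\<beta> t x)) * A ?\<beta> t x))"
    proof (rule integral_le)
      fix x
      have "- \<bar>\<phi>' (F ?\<beta> t x)\<bar> \<le> \<sigma> * (\<phi>' (F ?\<beta> t x) + ?\<beta> * \<phi> (F ?\<beta> t x))"
        using \<sigma> assms mult_nonneg_nonneg[OF _ \<phi>_nonneg[of "F ?\<beta> t x"], of \<kappa>]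
        by (elim disjE) (simp_all add: abs_if)
      from mult_right_mono[OF this A_nonneg[OF t]]
      show "- (\<bar>\<phi>' (F ?\<beta> t x)\<bar> * A ?\<beta> t x) \<le> \<sigma> * ((\<phi>' (F ?\<beta> t x) + ?\<beta> * \<phi> (F ?\<beta> t x)) * A ?\<beta> t x)"
        by (simp add: mult_ac)
    qed (use t in \<open>auto intro!: integrable_cont_X continuous_intros continuous_on_F continuous_on_A\<close>)
    finally show ?thesis by simp
  qed
  show ?thesis by (rule has_integral_le[OF err D le])
qed

text \<open>The quadratic terms cancel, so equality of two power distances with distinct centres
  describes a hyperplane. Pairs with coinciding centres are left out; their terms in
  \<open>A\<close> are zero.\<close>

lemma negligible_ties:
  "negligible (\<Union>(i, j)\<in>{(i, j)\<in>I \<times> I. P i t \<noteq> P j t}.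
    {x. power_dist (P i t) (\<rho> i) x = power_dist (P j t) (\<rho> j) x})" (is "negligible (\<Union>(i, j)\<in>?J. ?T i j)")
proof (rule negligible_Union)
  show "finite ((\<lambda>(i, j). ?T i j) ` ?J)"
    using I by (intro finite_imageI finite_subset[of ?J "I \<times> I"]) auto
  fix S assume "S \<in> (\<lambda>(i, j). ?T i j) ` ?J"
  then obtain i j where S: "S = ?T i j" "P i t \<noteq> P j t" by auto
  have "negligible {x. (P j t - P i t) \<bullet> x
      = ((P j t \<bullet> P j t - \<rho> j) - (P i t \<bullet> P i t - \<rho> i)) / 2}"
    using S(2) by (intro negligible_hyperplane) auto
  moreover have "S \<subseteq> {x. (P j t - P i t) \<bullet> x
      = ((P j t \<bullet> P j t - \<rho> j) - (P i t \<bullet> P i t - \<rho> i)) / 2}"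
    unfolding S(1) by (auto simp: power_dist_def inner_diff_left inner_diff_right inner_commute)
  ultimately show "negligible S" by (rule negligible_subset)
qed

text \<open>With all weights replaced by 1, a bound for \<open>A\<close> that depends neither on
  \<open>\<beta>\<close> nor on \<open>x\<close> and is continuous in \<open>t\<close>.\<close>

definition speed where
  "speed t = (\<Sum>i\<in>I. \<Sum>j\<in>I. (P i t - P j t) \<bullet> (V i t - V j t))"

lemma A_le_speed:
  assumes "t \<in> {a..b}"
  shows "A \<beta> t x \<le> speed t"
  unfolding A_def speed_def
  by (intro sum_mono mult_left_le_one_le mult_le_one mult_nonneg_nonneg soft_weight_le_1
      soft_weight_nonneg I expanding assms)

lemma continuous_on_speed: "continuous_on {a..b} speed"
  unfolding speed_def by (intro continuous_intros cont_P cont_V)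

lemma K_nonneg: "K \<ge> 0"
  using \<phi>'_le[of 0] by linarith

lemma err_integrand_le:
  assumes "t \<in> {a..b}"
  shows "\<bar>\<phi>' (F \<beta> t x)\<bar> * A \<beta> t x \<le> K * speed t"
  using assms by (intro mult_mono A_le_speed A_nonneg \<phi>'_le K_nonneg)

text \<open>Coinciding centres contribute zero outright; for the other pairs the product of weights
  decays exponentially in \<open>Suc k\<close>.\<close>

lemma A_tendsto_0:
  assumes "\<And>i j. \<lbrakk>i \<in> I; j \<in> I; P i t \<noteq> P j t\<rbrakk>
    \<Longrightarrow> power_dist (P i t) (\<rho> i) x \<noteq> power_dist (P j t) (\<rho> j) x"
  shows "(\<lambda>k. A (\<sigma> * Suc k) t x) \<longlonglongrightarrow> 0"
  unfolding A_def
proof (intro tendsto_null_sum)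
  fix i j assume ij: "i \<in> I" "j \<in> I"
  let ?c = "(P i t - P j t) \<bullet> (V i t - V j t)"
  let ?d = "power_dist (P i t) (\<rho> i) x - power_dist (P j t) (\<rho> j) x"
  show "(\<lambda>k. W (\<sigma> * Suc k) t i x * W (\<sigma> * Suc k) t j x * ?c) \<longlonglongrightarrow> 0"
  proof (cases "P i t = P j t")
    case False
    have "filterlim (\<lambda>k. Suc k * \<bar>?d\<bar>) at_top sequentially"
      using assms[OF ij False]
      by (intro filterlim_at_top_mult_tendsto_pos[OF tendsto_const]
          filterlim_compose[OF filterlim_real_sequentially filterlim_Suc]) auto
    then have "(\<lambda>k. exp (- (Suc k * \<bar>?d\<bar>))) \<longlonglongrightarrow> 0"
      by (intro filterlim_compose[OF exp_at_bot] filterlim_compose[OF filterlim_uminus_at_bot_at_top])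
    then have lim: "(\<lambda>k. exp (- (Suc k * \<bar>?d\<bar>)) * \<bar>?c\<bar>) \<longlonglongrightarrow> 0"
      by (rule tendsto_mult_left_zero)
    have "norm (W (\<sigma> * Suc k) t i x * W (\<sigma> * Suc k) t j x * ?c) \<le> exp (- (Suc k * \<bar>?d\<bar>)) * \<bar>?c\<bar>" for k
    proof -
      have eq: "\<bar>\<sigma> * Suc k * ?d\<bar> = Suc k * \<bar>?d\<bar>" using \<sigma> by (auto simp: abs_mult)
      have "W (\<sigma> * Suc k) t i x * W (\<sigma> * Suc k) t j x \<le> exp (- (Suc k * \<bar>?d\<bar>))"
        using soft_weight_mult_le[OF I ij, of "\<sigma> * Suc k" "\<lambda>j. P j t" \<rho> x] unfolding eq .
      then show ?thesis
        by (simp add: abs_mult soft_weight_nonneg[OF I] mult_right_mono del: of_nat_Suc)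
    qed
    with lim show ?thesis by (intro Lim_null_comparison[OF _ lim] always_eventually allI)
  qed simp
qed

lemma err_tendsto_0:
  assumes t: "t \<in> {a..b}"
  shows "(\<lambda>k. err (\<sigma> * Suc k) t) \<longlonglongrightarrow> 0"
proof -
  define T where "T = (\<Union>(i, j)\<in>{(i, j)\<in>I \<times> I. P i t \<noteq> P j t}.
    {x. power_dist (P i t) (\<rho> i) x = power_dist (P j t) (\<rho> j) x})"
  have T: "negligible T" unfolding T_def by (rule negligible_ties)
  let ?f = "\<lambda>k x. \<bar>\<phi>' (F (\<sigma> * Suc k) t x)\<bar> * A (\<sigma> * Suc k) t x"
  \<comment> \<open>Setting the integrand to 0 on the negligible set of ties makes the convergence
    hold at every point without changing the integrals.\<close>
  let ?g = "\<lambda>k x. if x \<in> T then 0 else ?f k x"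
  have "(\<lambda>k. integral X (?g k)) \<longlonglongrightarrow> integral X (\<lambda>_. 0)"
  proof (rule dominated_convergence)
    show "?g k integrable_on X" for k
    proof (rule integrable_spike[OF _ T])
      show "?f k integrable_on X"
        using t by (intro integrable_cont_X continuous_intros continuous_on_F continuous_on_A) auto
    qed auto
    show "(\<lambda>x. K * speed t) integrable_on X" by (rule integrable_const)
    show "norm (?g k x) \<le> K * speed t" for k x
      using err_integrand_le[OF t, of "\<sigma> * Suc k" x] A_nonneg[OF t, of "\<sigma> * Suc k" x]
        order_trans[OF mult_nonneg_nonneg[OF abs_ge_zero A_nonneg[OF t]] err_integrand_le[OF t]]
      by (auto simp: abs_mult simp del: of_nat_Suc)
    show "(\<lambda>k. ?g k x) \<longlonglongrightarrow> 0" for x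
    proof (cases "x \<in> T")
      case False
      have lim: "(\<lambda>k. K * A (\<sigma> * Suc k) t x) \<longlonglongrightarrow> 0"
        using False by (intro tendsto_mult_right_zero A_tendsto_0) (auto simp: T_def)
      have "norm (?f k x) \<le> K * A (\<sigma> * Suc k) t x" for k
        using mult_right_mono[OF \<phi>'_le A_nonneg[OF t]] A_nonneg[OF t] by (simp add: abs_mult del: of_nat_Suc)
      then have "(\<lambda>k. ?f k x) \<longlonglongrightarrow> 0"
        by (intro Lim_null_comparison[OF _ lim] always_eventually allI)
      then show ?thesis using False by simp
    qed simp
  qed
  moreover have "integral X (?g k) = err (\<sigma> * Suc k) t" for k
    unfolding err_def by (rule integral_spike[OF T]) auto
  ultimately show ?thesis by simp
qed

text \<open>A second dominated convergence, now in time: \<open>K * speed t\<close> times the volume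
  of the box dominates for all \<open>k\<close>.\<close>

lemma integral_err_tendsto_0: "(\<lambda>k. integral {a..b} (err (\<sigma> * Suc k))) \<longlonglongrightarrow> 0"
proof -
  have "(\<lambda>k. integral {a..b} (err (\<sigma> * Suc k))) \<longlonglongrightarrow> integral {a..b} (\<lambda>_. 0)"
  proof (rule dominated_convergence)
    show "(\<lambda>t. measure lborel X * (K * speed t)) integrable_on {a..b}"
      by (intro integrable_continuous_interval continuous_intros continuous_on_speed)
    fix k t assume t: "t \<in> {a..b}"
    have "0 \<le> err (\<sigma> * Suc k) t"
      unfolding err_def
      by (intro integral_nonneg integrable_cont_X continuous_intros continuous_on_F continuous_on_A
          mult_nonneg_nonneg A_nonneg) (use t in auto)
    moreover have "err (\<sigma> * Suc k) t \<le> integral X (\<lambda>_. K * speed t)"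
      unfolding err_def
      by (intro integral_le integrable_cont_X continuous_intros continuous_on_F continuous_on_A
          err_integrand_le) (use t in auto)
    ultimately show "norm (err (\<sigma> * Suc k) t) \<le> measure lborel X * (K * speed t)"
      by (simp add: mult_ac del: of_nat_Suc)
  qed (auto intro: integrable_continuous_interval continuous_on_err err_tendsto_0 simp del: of_nat_Suc)
  then show ?thesis by simp
qed

section \<open>From the soft to the true extremum\<close>

lemma H_tendsto:
  assumes t: "t \<in> {a..b}"
  shows "(\<lambda>k. H (\<sigma> * Suc k) t) \<longlonglongrightarrow> integral X (\<lambda>x. \<phi> (E t x))"
  unfolding H_def
proof (rule dominated_convergence)
  show "(\<lambda>x. \<phi> (F (\<sigma> * Suc k) t x)) integrable_on X" for k
    using t by (intro integrable_cont_X continuous_intros continuous_on_F) auto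
  show "(\<lambda>x. K) integrable_on X" by (rule integrable_const)
  show "norm (\<phi> (F (\<sigma> * Suc k) t x)) \<le> K" for k x
    using \<phi>_nonneg \<phi>_le by simp
  fix x
  have "(\<lambda>k. card I / Suc k) \<longlonglongrightarrow> 0"
    by (rule LIMSEQ_Suc[OF lim_const_over_n])
  then have "(\<lambda>k. F (\<sigma> * Suc k) t x - E t x) \<longlonglongrightarrow> 0"
    by (rule Lim_null_comparison[rotated]) (use abs_F_diff_E_le in \<open>auto intro!: always_eventually\<close>)
  then have "(\<lambda>k. F (\<sigma> * Suc k) t x) \<longlonglongrightarrow> E t x"
    by (simp add: LIM_zero_iff)
  then show "(\<lambda>k. \<phi> (F (\<sigma> * Suc k) t x)) \<longlonglongrightarrow> \<phi> (E t x)"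
    using deriv_\<phi> DERIV_isCont by (intro isCont_tendsto_compose[of _ \<phi>]) blast+
qed

text \<open>In the lower bound for the increment of \<open>H\<close> the error tends to 0, while
  \<open>H\<close> tends to the integral for the true extremum.\<close>

lemma integral_ext_power_mono:
  "\<sigma> * integral X (\<lambda>x. \<phi> (E a x)) \<le> \<sigma> * integral X (\<lambda>x. \<phi> (E b x))"
proof -
  have "(\<lambda>k. \<sigma> * (H (\<sigma> * Suc k) b - H (\<sigma> * Suc k) a) + integral {a..b} (err (\<sigma> * Suc k))) \<longlonglongrightarrow>
      \<sigma> * (integral X (\<lambda>x. \<phi> (E b x)) - integral X (\<lambda>x. \<phi> (E a x))) + 0"
    using ab by (intro tendsto_intros H_tendsto integral_err_tendsto_0) auto
  moreover have "0 \<le> \<sigma> * (H (\<sigma> * Suc k) b - H (\<sigma> * Suc k) a) + integral {a..b} (err (\<sigma> * Suc k))" for k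
    using H_diff_ge[of "Suc k"] by simp
  ultimately have "0 \<le> \<sigma> * (integral X (\<lambda>x. \<phi> (E b x)) - integral X (\<lambda>x. \<phi> (E a x))) + 0"
    by (intro LIMSEQ_le_const) auto
  then show ?thesis by (simp add: algebra_simps)
qed

end

subsection \<open>Piecewise smooth expansions\<close>

text \<open>Induction on \<open>S\<close> splits the interval at each exceptional time inside it.
  Without exceptional times, closed subintervals of the open interval exhaust it and continuity
  carries the inequality to the ends.\<close>

lemma le_endpoints_except_finite:
  fixes h :: "real \<Rightarrow> real"
  assumes "finite S" "a \<le> b" "continuous_on {a..b} h"
    and "\<And>c d. \<lbrakk>c \<le> d; {c..d} \<subseteq> {a<..<b} - S\<rbrakk> \<Longrightarrow> h c \<le> h d"
  shows "h a \<le> h b"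
  using assms
proof (induction S arbitrary: a b rule: finite_induct)
  case empty
  show ?case
  proof (cases "a = b")
    case False
    with empty have ab: "a < b" by simp
    \<comment> \<open>Both sequences start at the midpoint, so \<open>c k \<le> d k\<close> from
      \<open>k = 0\<close> on.\<close>
    define c d where "c = (\<lambda>k. a + (b - a) / 2 * (1 / real (Suc k)))"
      and "d = (\<lambda>k. b - (b - a) / 2 * (1 / real (Suc k)))"
    have "(\<lambda>k. 1 / real (Suc k)) \<longlonglongrightarrow> 0"
      by (rule LIMSEQ_Suc[OF lim_const_over_n])
    then have "c \<longlonglongrightarrow> a + (b - a) / 2 * 0" "d \<longlonglongrightarrow> b - (b - a) / 2 * 0"
      unfolding c_def d_def by (intro tendsto_intros; assumption)+
    then have lim: "c \<longlonglongrightarrow> a" "d \<longlonglongrightarrow> b" by simp_all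
    have cd: "a < c k" "c k \<le> d k" "d k < b" for k
    proof -
      have "(b - a) / 2 * (1 / real (Suc k)) \<le> (b - a) / 2 * 1" "0 < (b - a) / 2 * (1 / real (Suc k))"
        using ab by (intro mult_left_mono mult_pos_pos; simp)+
      moreover have "b - (b - a) / 2 = a + (b - a) / 2" by (simp add: field_simps)
      ultimately show "a < c k" "c k \<le> d k" "d k < b" unfolding c_def d_def by linarith+
    qed
    have "h (c k) \<le> h (d k)" for k
      using cd[of k] by (intro empty.prems) auto
    moreover have mem: "c k \<in> {a..b}" "d k \<in> {a..b}" for k
      using cd[of k] by auto
    moreover have "(\<lambda>k. h (c k)) \<longlonglongrightarrow> h a" "(\<lambda>k. h (d k)) \<longlonglongrightarrow> h b"
      using lim mem ab by (auto intro!: continuous_on_tendsto_compose[OF empty.prems(2)])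
    ultimately show ?thesis by (intro LIMSEQ_le) auto
  qed simp
next
  case (insert s S)
  show ?case
  proof (cases "s \<in> {a<..<b}")
    case True
    have "h a \<le> h s"
    proof (rule insert.IH)
      fix c d assume "c \<le> d" "{c..d} \<subseteq> {a<..<s} - S"
      moreover have "{a<..<s} - S \<subseteq> {a<..<b} - insert s S" using True by auto
      ultimately show "h c \<le> h d" by (intro insert.prems(3)) blast+
    qed (use True in \<open>auto intro: continuous_on_subset[OF insert.prems(2)]\<close>)
    also have "h s \<le> h b"
    proof (rule insert.IH)
      fix c d assume "c \<le> d" "{c..d} \<subseteq> {s<..<b} - S"
      moreover have "{s<..<b} - S \<subseteq> {a<..<b} - insert s S" using True by auto
      ultimately show "h c \<le> h d" by (intro insert.prems(3)) blast+
    qed (use True in \<open>auto intro: continuous_on_subset[OF insert.prems(2)]\<close>)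
    finally show ?thesis .
  next
    case False
    show ?thesis
    proof (rule insert.IH)
      fix c d assume "c \<le> d" "{c..d} \<subseteq> {a<..<b} - S"
      moreover have "{a<..<b} - S \<subseteq> {a<..<b} - insert s S" using False by auto
      ultimately show "h c \<le> h d" by (intro insert.prems(3)) blast+
    qed fact+
  qed
qed

lemma infinitely_differentiable_onD:
  assumes "infinitely_differentiable_on f U" "t \<in> U"
  shows "(f has_real_derivative deriv f t) (at t)" "isCont (deriv f) t"
proof -
  have "((deriv ^^ 0) f) field_differentiable (at t)" "((deriv ^^ 1) f) field_differentiable (at t)"
    using assms unfolding infinitely_differentiable_on_def by blast+
  then show "(f has_real_derivative deriv f t) (at t)" "isCont (deriv f) t"
    by (auto simp: field_differentiable_derivI field_differentiable_imp_continuous_at)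
qed

lemma has_vector_derivative_componentwise_deriv:
  fixes f :: "real \<Rightarrow> 'a::euclidean_space"
  assumes "\<And>b. b \<in> Basis \<Longrightarrow> ((\<lambda>t. f t \<bullet> b) has_real_derivative d b) (at t)"
  shows "(f has_vector_derivative (\<Sum>b\<in>Basis. d b *\<^sub>R b)) (at t)"
  unfolding has_vector_derivative_def
  by (subst has_derivative_componentwise_within)
    (use assms in \<open>auto simp: has_field_derivative_def inner_sum_left inner_Basis mult_commute_abs
        if_distrib sum.delta cong: if_cong\<close>)

text \<open>The left-hand side is half the derivative of the squared distance, which is monotone
  because the distance is.\<close>

lemma expansion_motion_expanding:
  assumes "expansion_motion N p q P" "i \<in> {1..N}" "j \<in> {1..N}" "t \<in> {0<..<1}"
    and "(P i has_vector_derivative v) (at t)" "(P j has_vector_derivative w) (at t)"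
  shows "(P i t - P j t) \<bullet> (v - w) \<ge> 0"
proof -
  have lt: "mono_on {0..1} (\<lambda>t. dist (P k t) (P l t))" if "k \<in> {1..N}" "l \<in> {1..N}" "k < l" for k l
    using assms(1) that unfolding expansion_motion_def by blast
  have *: "mono_on {0..1} (\<lambda>t. dist (P i t) (P j t))"
  proof (cases i j rule: linorder_cases)
    case less
    with lt assms(2,3) show ?thesis by blast
  next
    case equal
    then show ?thesis by (auto intro: mono_onI)
  next
    case greater
    with lt[of j i] assms(2,3) show ?thesis by (simp add: dist_commute)
  qed
  have "mono_on {0..1} (\<lambda>t. (P i t - P j t) \<bullet> (P i t - P j t))"
  proof (rule mono_onI)
    fix s t :: real assume "s \<in> {0..1}" "t \<in> {0..1}" "s \<le> t"
    from mono_onD[OF * this] have "(dist (P i s) (P j s))\<^sup>2 \<le> (dist (P i t) (P j t))\<^sup>2"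
      by (intro power_mono) auto
    then show "(P i s - P j s) \<bullet> (P i s - P j s) \<le> (P i t - P j t) \<bullet> (P i t - P j t)"
      by (simp add: dist_norm power2_norm_eq_inner)
  qed
  moreover have "((\<lambda>t. (P i t - P j t) \<bullet> (P i t - P j t)) has_real_derivative
      2 * ((P i t - P j t) \<bullet> (v - w))) (at t)"
    using assms(5,6) unfolding has_real_derivative_iff_has_vector_derivative
    by (auto simp: has_vector_derivative_def inner_commute algebra_simps intro!: derivative_eq_intros)
  moreover have "t \<in> interior {0..1}" using assms(4) by (simp add: interior_atLeastAtMost_real)
  ultimately have "0 \<le> 2 * ((P i t - P j t) \<bullet> (v - w))" by (rule mono_on_imp_deriv_nonneg)
  then show ?thesis by simp
qed

text \<open>The threshold \<open>L0\<close> depends on \<open>M\<close> but not on the test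
  function, so one box can serve a whole sequence of test functions with the same
  \<open>M\<close>.\<close>

lemma integral_ext_power_mono_expansion:
  fixes p q :: "nat \<Rightarrow> 'a::euclidean_space"
  assumes "piecewise_smooth_expansion N p q" and N: "N \<ge> 1" and \<sigma>: "\<sigma> = 1 \<or> \<sigma> = -1"
  obtains L0 where "\<And>L \<phi> \<phi>' K. \<lbrakk>L \<ge> L0; test_function \<phi> \<phi>' M K\<rbrakk> \<Longrightarrow>
    \<sigma> * integral (cbox (- (L *\<^sub>R One)) (L *\<^sub>R One)) (\<lambda>x. \<phi> (ext_power \<sigma> {1..N} p \<rho> x))
    \<le> \<sigma> * integral (cbox (- (L *\<^sub>R One)) (L *\<^sub>R One)) (\<lambda>x. \<phi> (ext_power \<sigma> {1..N} q \<rho> x))"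
proof -
  obtain P S where P: "expansion_motion N p q P" and S: "finite S"
    and smooth: "\<And>i b. \<lbrakk>i \<in> {1..N}; b \<in> Basis\<rbrakk> \<Longrightarrow>
      infinitely_differentiable_on (\<lambda>t. P i t \<bullet> b) ({0<..<1} - S)"
    using assms(1) unfolding piecewise_smooth_expansion_def by blast
  define V where "V = (\<lambda>i t. \<Sum>b\<in>Basis. deriv (\<lambda>t. P i t \<bullet> b) t *\<^sub>R b)"
  have I: "finite {1..N}" "{1..N} \<noteq> {}" using N by auto
  have cont_P: "continuous_on {0..1} (P i)" and P01: "P i 0 = p i" "P i 1 = q i" if "i \<in> {1..N}" for i
    using P that unfolding expansion_motion_def by auto
  have deriv_P: "(P i has_vector_derivative V i t) (at t)" if "i \<in> {1..N}" "t \<in> {0<..<1} - S" for i t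
    unfolding V_def
    by (intro has_vector_derivative_componentwise_deriv infinitely_differentiable_onD[OF smooth] that)
  have cont_V: "isCont (V i) t" if "i \<in> {1..N}" "t \<in> {0<..<1} - S" for i t
    unfolding V_def by (intro continuous_intros infinitely_differentiable_onD[OF smooth] that)
  have "bounded (\<Union>i\<in>{1..N}. P i ` {0..1})"
    by (intro bounded_UN ballI compact_imp_bounded compact_continuous_image cont_P) auto
  then obtain B where B: "\<And>i t. \<lbrakk>i \<in> {1..N}; t \<in> {0..1}\<rbrakk> \<Longrightarrow> norm (P i t) \<le> B"
    unfolding bounded_iff by blast
  \<comment> \<open>Large enough to dominate \<open>M + N + \<rho> i\<close> for every index, and at
    least 1 so that \<open>R \<le> R\<^sup>2\<close> from \<open>R0\<close> on.\<close>
  define R0 where "R0 = 1 + \<bar>M\<bar> + N + (\<Sum>i\<in>{1..N}. \<bar>\<rho> i\<bar>)"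
  have R0: "R0 \<ge> 1" unfolding R0_def by (simp add: sum_nonneg)
  have \<rho>_R0: "M + N + \<rho> i \<le> R\<^sup>2" if "i \<in> {1..N}" "R \<ge> R0" for i R
  proof -
    have "\<bar>\<rho> i\<bar> \<le> (\<Sum>i\<in>{1..N}. \<bar>\<rho> i\<bar>)" using that by (intro member_le_sum) auto
    then have "M + N + \<rho> i \<le> R0" unfolding R0_def by linarith
    also have "R0 \<le> R" by fact
    also have "R \<le> R\<^sup>2" using R0 that by (intro self_le_power) auto
    finally show ?thesis .
  qed
  show thesis
  proof (rule that[of "R0 + 2 * B"])
    fix L \<phi> \<phi>' K assume L: "L \<ge> R0 + 2 * B" and "test_function \<phi> \<phi>' M K"
    then interpret test_function \<phi> \<phi>' M K by simp
    let ?X = "cbox (- (L *\<^sub>R One)) (L *\<^sub>R One) :: 'a set"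
    let ?h = "\<lambda>t. \<sigma> * integral ?X (\<lambda>x. \<phi> (ext_power \<sigma> {1..N} (\<lambda>j. P j t) \<rho> x))"
    have "?h 0 \<le> ?h 1"
    proof (rule le_endpoints_except_finite[OF S, where a = 0 and b = 1 and h = ?h])
      show "continuous_on {0..1} ?h"
        by (intro continuous_intros integral_continuous_on_param)
          (unfold case_prod_beta, intro continuous_intros continuous_on_\<phi> continuous_on_ext_power[OF I]
            continuous_on_compose2[OF cont_P continuous_on_fst], auto)
      fix c d :: real assume cd: "c \<le> d" "{c..d} \<subseteq> {0<..<1} - S"
      \<comment> \<open>With \<open>L - 2 * B\<close> in the role of \<open>R\<close>, the box of
        the locale is exactly \<open>?X\<close>, the same for all pieces.\<close>
      have piece: "smooth_piece \<phi> \<phi>' M K {1..N} P V \<rho> c d \<sigma> B (L - 2 * B)"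
      proof (unfold_locales)
        show "M + real (card {1..N}) + \<rho> i \<le> (L - 2 * B)\<^sup>2" if i: "i \<in> {1..N}" for i
          using \<rho>_R0[OF i] L by simp
        show "continuous_on {c..d} (V i)" if i: "i \<in> {1..N}" for i
          using cont_V[OF i] cd by (intro continuous_at_imp_continuous_on) auto
        have t': "t \<in> {0<..<1} - S" "t \<in> {0..1}" if "t \<in> {c..d}" for t
          using cd that by auto
        show "(P i has_vector_derivative V i t) (at t within {c..d})" "norm (P i t) \<le> B"
          if "i \<in> {1..N}" "t \<in> {c..d}" for i t
          using deriv_P[OF that(1) t'(1)] B[OF that(1) t'(2)] that(2)
          by (auto intro: has_vector_derivative_at_within)
        show "(P i t - P j t) \<bullet> (V i t - V j t) \<ge> 0"
          if "i \<in> {1..N}" "j \<in> {1..N}" "t \<in> {c..d}" for i j t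
          using t'[OF that(3)] that by (intro expansion_motion_expanding[OF P] deriv_P) auto
      qed (use I cd \<sigma> L R0 in auto)
      have "L - 2 * B + 2 * B = L" by simp
      from smooth_piece.integral_ext_power_mono[OF piece, unfolded this]
      show "?h c \<le> ?h d" .
    qed simp
    moreover have "ext_power \<sigma> {1..N} (\<lambda>j. P j 0) \<rho> = ext_power \<sigma> {1..N} p \<rho>"
      "ext_power \<sigma> {1..N} (\<lambda>j. P j 1) \<rho> = ext_power \<sigma> {1..N} q \<rho>"
      using P01 by (auto simp: ext_power_def intro!: ext arg_cong[where f = Min] image_cong)
    ultimately show "\<sigma> * integral ?X (\<lambda>x. \<phi> (ext_power \<sigma> {1..N} p \<rho> x))
      \<le> \<sigma> * integral ?X (\<lambda>x. \<phi> (ext_power \<sigma> {1..N} q \<rho> x))" by simp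
  qed
qed

section \<open>Test functions approximating the indicator of a layer\<close>

lemma has_derivative_max0_squared:
  "((\<lambda>u. (max 0 u)\<^sup>2) has_real_derivative 2 * max 0 u) (at u)"
proof (cases u "0::real" rule: linorder_cases)
  case less
  have "((\<lambda>u. 0) has_real_derivative 2 * max 0 u) (at u)" using less by simp
  then show ?thesis
    by (rule has_field_derivative_transform_within_open[where S = "{..<0}"]) (use less in auto)
next
  case greater
  have "((\<lambda>u. u\<^sup>2) has_real_derivative 2 * max 0 u) (at u)"
    using greater by (auto intro!: derivative_eq_intros)
  then show ?thesis
    by (rule has_field_derivative_transform_within_open[where S = "{0<..}"]) (use greater in auto)
next
  case equal
  have "((\<lambda>h::real. ((max 0 (0 + h))\<^sup>2 - (max 0 0)\<^sup>2) / h) \<longlongrightarrow> 0) (at 0)"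
  proof (rule Lim_null_comparison)
    show "\<forall>\<^sub>F h::real in at 0. norm (((max 0 (0 + h))\<^sup>2 - (max 0 0)\<^sup>2) / h) \<le> \<bar>h\<bar>"
      by (intro always_eventually) (auto simp: max_def power2_eq_square)
    show "((\<lambda>h::real. \<bar>h\<bar>) \<longlongrightarrow> 0) (at 0)" by (intro tendsto_eq_intros) auto
  qed
  then show ?thesis using equal by (simp add: DERIV_def)
qed

text \<open>The function \<open>s\<close> is continuously differentiable and positive exactly
  between 0 and \<open>\<epsilon>\<close>; the map \<open>v / (1 + v)\<close> sends
  \<open>k * s\<close> into the unit interval and, as \<open>k\<close> grows, towards the indicator
  of that open interval.\<close>

lemma layer_test_function:
  fixes \<epsilon> k :: real
  assumes "\<epsilon> > 0" "k \<ge> 0"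
  defines "s \<equiv> \<lambda>u. (max 0 (u * (\<epsilon> - u)))\<^sup>2"
    and "s' \<equiv> \<lambda>u. 2 * max 0 (u * (\<epsilon> - u)) * (\<epsilon> - 2 * u)"
  shows "test_function (\<lambda>u. k * s u / (1 + k * s u)) (\<lambda>u. k * s' u / (1 + k * s u)\<^sup>2) \<epsilon>
    (max 1 (k * (2 * \<epsilon>\<^sup>2 * \<epsilon>)))"
proof
  have ks: "k * s u \<ge> 0" for u using assms by simp
  then have nz: "1 + k * s u \<noteq> 0" for u by (metis add_pos_nonneg less_irrefl zero_less_one)
  fix u :: real
  have "((\<lambda>u. u * (\<epsilon> - u)) has_real_derivative \<epsilon> - 2 * u) (at u)"
    by (auto intro!: derivative_eq_intros)
  from DERIV_chain2[OF has_derivative_max0_squared this]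
  have ds: "(s has_real_derivative s' u) (at u)" by (simp add: s_def s'_def)
  show "((\<lambda>u. k * s u / (1 + k * s u)) has_real_derivative k * s' u / (1 + k * s u)\<^sup>2) (at u)"
    using nz[of u] by (auto intro!: derivative_eq_intros ds simp: power2_eq_square field_simps)
  show "continuous_on UNIV (\<lambda>u. k * s' u / (1 + k * s u)\<^sup>2)"
    using nz unfolding s_def s'_def by (auto intro!: continuous_intros)
  show "0 \<le> k * s u / (1 + k * s u)" using ks[of u] by simp
  have "k * s u / (1 + k * s u) \<le> 1" using ks[of u] by (simp add: field_simps)
  then show "k * s u / (1 + k * s u) \<le> max 1 (k * (2 * \<epsilon>\<^sup>2 * \<epsilon>))" by simp
  have "\<bar>s' u\<bar> \<le> 2 * \<epsilon>\<^sup>2 * \<epsilon>"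
  proof (cases "0 \<le> u \<and> u \<le> \<epsilon>")
    case True
    then have "u * (\<epsilon> - u) \<le> \<epsilon> * \<epsilon>" "0 \<le> u * (\<epsilon> - u)" by (auto intro!: mult_mono)
    moreover have "\<bar>\<epsilon> - 2 * u\<bar> \<le> \<epsilon>" using True by auto
    ultimately show ?thesis
      unfolding s'_def abs_mult by (auto intro!: mult_mono simp: power2_eq_square)
  next
    case False
    then have "u * (\<epsilon> - u) \<le> 0" using assms by (auto simp: mult_le_0_iff)
    then show ?thesis using assms by (simp add: s'_def max_def)
  qed
  then have "k * \<bar>s' u\<bar> / (1 + k * s u)\<^sup>2 \<le> k * (2 * \<epsilon>\<^sup>2 * \<epsilon>) / 1"
    using ks[of u] assms by (intro frac_le mult_left_mono) (auto intro!: one_le_power)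
  then show "\<bar>k * s' u / (1 + k * s u)\<^sup>2\<bar> \<le> max 1 (k * (2 * \<epsilon>\<^sup>2 * \<epsilon>))"
    using assms by (simp add: abs_mult)
  assume "u \<ge> \<epsilon>"
  then have "u * (\<epsilon> - u) \<le> 0" using assms by (auto simp: mult_le_0_iff)
  then show "k * s u / (1 + k * s u) = 0" "k * s' u / (1 + k * s u)\<^sup>2 = 0"
    by (simp_all add: s_def s'_def max_def)
qed

lemma continuous_ext_power:
  "finite I \<Longrightarrow> I \<noteq> {} \<Longrightarrow> continuous_on UNIV (ext_power \<sigma> I c \<rho>)"
  using continuous_on_ext_power[of I UNIV "\<lambda>j _. c j" "\<lambda>x. x" \<sigma> \<rho>] by (auto intro: continuous_intros)

text \<open>The extremum is always one of the power distances, so a union of balls covers the set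
  even for the maximum.\<close>

lemma bounded_ext_power_le:
  assumes "finite I" "I \<noteq> {}" "\<sigma> = 1 \<or> \<sigma> = -1"
  shows "bounded {x. ext_power \<sigma> I c \<rho> x \<le> M}"
proof (rule bounded_subset)
  show "bounded (\<Union>j\<in>I. cball (c j) (sqrt (M + \<rho> j)))" using assms by auto
  show "{x. ext_power \<sigma> I c \<rho> x \<le> M} \<subseteq> (\<Union>j\<in>I. cball (c j) (sqrt (M + \<rho> j)))"
  proof
    fix x assume x: "x \<in> {x. ext_power \<sigma> I c \<rho> x \<le> M}"
    obtain j where j: "j \<in> I" "ext_power \<sigma> I c \<rho> x = power_dist (c j) (\<rho> j) x"
      using ext_power_attained[OF assms] by blast
    with x have "(norm (x - c j))\<^sup>2 \<le> M + \<rho> j"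
      by (simp add: power_dist_def power2_norm_eq_inner)
    then have "dist (c j) x \<le> sqrt (M + \<rho> j)"
      by (simp add: dist_norm norm_minus_commute real_le_rsqrt)
    with j show "x \<in> (\<Union>j\<in>I. cball (c j) (sqrt (M + \<rho> j)))" by auto
  qed
qed

text \<open>The integrands are bounded by 1 and converge at every point: on the boundary values 0
  and \<open>\<epsilon>\<close> the function \<open>s\<close> vanishes, which matches the strict
  inequalities of the layer.\<close>

lemma tendsto_integral_layer:
  fixes f :: "'a::euclidean_space \<Rightarrow> real" and \<epsilon> :: real
  assumes f: "continuous_on UNIV f" and \<epsilon>: "\<epsilon> > 0" and sub: "{x. 0 < f x \<and> f x < \<epsilon>} \<subseteq> cbox a b"
  defines "s \<equiv> \<lambda>u. (max 0 (u * (\<epsilon> - u)))\<^sup>2"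
  shows "(\<lambda>k. integral (cbox a b) (\<lambda>x. real k * s (f x) / (1 + real k * s (f x))))
    \<longlonglongrightarrow> measure lborel {x. 0 < f x \<and> f x < \<epsilon>}"
proof -
  let ?U = "{x. 0 < f x \<and> f x < \<epsilon>}"
  have s0: "s u \<ge> 0" for u by (simp add: s_def)
  have nz: "1 + real k * s u > 0" for k u
    using s0[of u] by (intro add_pos_nonneg) auto
  have "open ?U"
    using f by (intro open_Collect_conj open_Collect_less) auto
  then have U: "?U \<in> sets borel" by simp
  have "(\<lambda>k. integral (cbox a b) (\<lambda>x. real k * s (f x) / (1 + real k * s (f x))))
    \<longlonglongrightarrow> integral (cbox a b) (indicat_real ?U)"
  proof (rule dominated_convergence)
    show "(\<lambda>x. real k * s (f x) / (1 + real k * s (f x))) integrable_on cbox a b" for k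
      using nz[of k] unfolding s_def
      by (intro integrable_continuous continuous_intros continuous_on_subset[OF f])
        (auto simp: less_imp_neq[symmetric])
    show "(\<lambda>x. 1::real) integrable_on cbox a b" by (rule integrable_const)
    show "norm (real k * s (f x) / (1 + real k * s (f x))) \<le> 1" for k x
      using nz[of k "f x"] s0[of "f x"] by (simp add: field_simps)
    fix x
    show "(\<lambda>k. real k * s (f x) / (1 + real k * s (f x))) \<longlonglongrightarrow> indicat_real ?U x"
    proof (cases "x \<in> ?U")
      case True
      then have "s (f x) > 0" by (auto simp: s_def)
      then have "filterlim (\<lambda>k. 1 + real k * s (f x)) at_top sequentially"
        by (intro filterlim_tendsto_add_at_top[OF tendsto_const]
            filterlim_at_top_mult_tendsto_pos[OF tendsto_const] filterlim_real_sequentially)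
      then have "(\<lambda>k. 1 - inverse (1 + real k * s (f x))) \<longlonglongrightarrow> 1 - 0"
        by (intro tendsto_diff[OF tendsto_const] tendsto_inverse_0_at_top)
      moreover have "1 - inverse (1 + real k * s (f x)) = real k * s (f x) / (1 + real k * s (f x))" for k
        using nz[of k "f x"] by (simp add: field_simps)
      ultimately have "(\<lambda>k. real k * s (f x) / (1 + real k * s (f x))) \<longlonglongrightarrow> 1" by simp
      then show ?thesis using True by simp
    next
      case False
      then have "f x * (\<epsilon> - f x) \<le> 0" using \<epsilon> by (auto simp: mult_le_0_iff)
      then have "s (f x) = 0" by (simp add: s_def max_def)
      then show ?thesis using False by simp
    qed
  qed
  also have "integral (cbox a b) (indicat_real ?U) = measure lebesgue (?U \<inter> cbox a b)"
    using U sub by (intro integral_indicator bounded_set_imp_lmeasurable bounded_Int) auto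
  also have "\<dots> = measure lborel ?U"
    using U sub by (simp add: Int_absorb2 measure_completion)
  finally show ?thesis .
qed

text \<open>One box contains the layers of both configurations and is admissible for all
  \<open>k\<close>, so the inequality of integrals survives the limit.\<close>

lemma measure_layer_mono_expansion:
  fixes p q :: "nat \<Rightarrow> 'a::euclidean_space"
  assumes exp: "piecewise_smooth_expansion N p q" and N: "N \<ge> 1" and \<sigma>: "\<sigma> = 1 \<or> \<sigma> = -1"
    and \<epsilon>: "\<epsilon> > 0"
  shows "\<sigma> * measure lborel {x. 0 < ext_power \<sigma> {1..N} p \<rho> x \<and> ext_power \<sigma> {1..N} p \<rho> x < \<epsilon>}
    \<le> \<sigma> * measure lborel {x. 0 < ext_power \<sigma> {1..N} q \<rho> x \<and> ext_power \<sigma> {1..N} q \<rho> x < \<epsilon>}"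
proof -
  have I: "finite {1..N}" "{1..N} \<noteq> {}" using N by auto
  obtain L0 where L0: "\<And>L \<phi> \<phi>' K. \<lbrakk>L \<ge> L0; test_function \<phi> \<phi>' \<epsilon> K\<rbrakk> \<Longrightarrow>
    \<sigma> * integral (cbox (- (L *\<^sub>R One)) (L *\<^sub>R One)) (\<lambda>x. \<phi> (ext_power \<sigma> {1..N} p \<rho> x))
    \<le> \<sigma> * integral (cbox (- (L *\<^sub>R One)) (L *\<^sub>R One)) (\<lambda>x. \<phi> (ext_power \<sigma> {1..N} q \<rho> x))"
    using integral_ext_power_mono_expansion[OF exp N \<sigma>] by blast
  have "bounded ({x. ext_power \<sigma> {1..N} p \<rho> x \<le> \<epsilon>} \<union> {x. ext_power \<sigma> {1..N} q \<rho> x \<le> \<epsilon>})"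
    unfolding bounded_Un by (intro conjI bounded_ext_power_le[OF I \<sigma>])
  then obtain L1 where L1: "\<And>x. ext_power \<sigma> {1..N} p \<rho> x \<le> \<epsilon> \<Longrightarrow> norm x \<le> L1"
    "\<And>x. ext_power \<sigma> {1..N} q \<rho> x \<le> \<epsilon> \<Longrightarrow> norm x \<le> L1"
    unfolding bounded_iff by blast
  define L where "L = max L0 L1"
  have "L0 \<le> L" "L1 \<le> L" by (auto simp: L_def)
  have sub: "{x. 0 < ext_power \<sigma> {1..N} c \<rho> x \<and> ext_power \<sigma> {1..N} c \<rho> x < \<epsilon>}
      \<subseteq> cbox (- (L *\<^sub>R One)) (L *\<^sub>R One)" if "c \<in> {p, q}" for c
  proof
    fix x assume "x \<in> {x. 0 < ext_power \<sigma> {1..N} c \<rho> x \<and> ext_power \<sigma> {1..N} c \<rho> x < \<epsilon>}"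
    with L1[of x] that have "norm x \<le> L1" by auto
    with \<open>L1 \<le> L\<close> show "x \<in> cbox (- (L *\<^sub>R One)) (L *\<^sub>R One)"
      by (intro norm_le_imp_mem_cbox_One) simp
  qed
  note lim = tendsto_mult_left[OF tendsto_integral_layer[OF continuous_ext_power[OF I] \<epsilon> sub], of _ \<sigma>]
  show ?thesis
    by (rule LIMSEQ_le[OF lim lim])
      (use L0[OF \<open>L0 \<le> L\<close> layer_test_function[OF \<epsilon>]] in \<open>auto intro!: exI[of _ 0]\<close>)
qed

subsection \<open>Descending by two dimensions\<close>

text \<open>The additional coordinates add the same \<open>y \<bullet> y\<close> to every power
  distance, and adding a constant commutes with \<open>Min\<close>.\<close>

lemma ext_power_Pair_0:
  assumes "finite I" "I \<noteq> {}" "\<sigma> = 1 \<or> \<sigma> = -1"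
  shows "ext_power \<sigma> I (\<lambda>i. (c i, 0)) \<rho> (x, y) = ext_power \<sigma> I c \<rho> x + y \<bullet> y"
proof -
  have "(\<lambda>j. \<sigma> * power_dist (c j, 0) (\<rho> j) (x, y)) = (\<lambda>j. \<sigma> * power_dist (c j) (\<rho> j) x + \<sigma> * (y \<bullet> y))"
    by (intro ext) (simp add: power_dist_def inner_Pair algebra_simps)
  then have "Min ((\<lambda>j. \<sigma> * power_dist (c j, 0) (\<rho> j) (x, y)) ` I)
      = Min ((\<lambda>j. \<sigma> * power_dist (c j) (\<rho> j) x) ` I) + \<sigma> * (y \<bullet> y)"
    using assms by (simp only:) (rule Min_add_commute)
  then show ?thesis
    using assms(3) by (auto simp: ext_power_def algebra_simps)
qed

text \<open>For \<open>u \<le> 0\<close> the set is an open disc of squared radius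
  \<open>\<epsilon> - u\<close> without a closed disc of squared radius \<open>- u\<close>. Areas in
  the plane are linear in the squared radius, so \<open>u\<close> cancels; here the choice of two
  extra dimensions matters. For \<open>u > 0\<close> the disc of squared radius
  \<open>\<epsilon>\<close> covers the set.\<close>

lemma emeasure_annulus_le:
  fixes u \<epsilon> :: real
  assumes "\<epsilon> > 0"
  shows "emeasure lborel {y::real^2. 0 < u + y \<bullet> y \<and> u + y \<bullet> y < \<epsilon>} \<le> ennreal (pi * \<epsilon>) * indicator {..<\<epsilon>} u"
    and "u \<le> 0 \<Longrightarrow> emeasure lborel {y::real^2. 0 < u + y \<bullet> y \<and> u + y \<bullet> y < \<epsilon>} = ennreal (pi * \<epsilon>)"
proof -
  let ?A = "{y::real^2. 0 < u + y \<bullet> y \<and> u + y \<bullet> y < \<epsilon>}"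
  have ball: "ball 0 (sqrt s) = {y::real^2. y \<bullet> y < s}" for s
    by (auto simp: norm_eq_sqrt_inner)
  have cball: "cball 0 (sqrt s) = {y::real^2. y \<bullet> y \<le> s}" for s
    by (auto simp: norm_eq_sqrt_inner)
  have area: "emeasure lborel (ball 0 (sqrt s) :: (real^2) set) = ennreal (pi * s)"
    "emeasure lborel (cball 0 (sqrt s) :: (real^2) set) = ennreal (pi * s)" if "s \<ge> 0" for s
    using that by (simp_all add: emeasure_ball emeasure_cball eval_unit_ball_vol)
  show eq: "emeasure lborel ?A = ennreal (pi * \<epsilon>)" if u: "u \<le> 0"
  proof -
    have "?A = ball 0 (sqrt (\<epsilon> - u)) - cball 0 (sqrt (- u))"
      unfolding ball cball by auto
    also have "emeasure lborel \<dots> = emeasure lborel (ball 0 (sqrt (\<epsilon> - u)) :: (real^2) set)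
        - emeasure lborel (cball 0 (sqrt (- u)) :: (real^2) set)"
    proof (rule emeasure_Diff)
      show "emeasure lborel (cball 0 (sqrt (- u)) :: (real^2) set) \<noteq> \<infinity>"
        using u by (simp add: area)
      show "cball 0 (sqrt (- u)) \<subseteq> (ball 0 (sqrt (\<epsilon> - u)) :: (real^2) set)"
        unfolding ball cball using assms by auto
    qed auto
    also have "\<dots> = ennreal (pi * \<epsilon>)"
      using u assms ennreal_minus[of "pi * - u" "pi * (\<epsilon> - u)"]
      by (simp add: area mult_nonneg_nonpos algebra_simps)
    finally show ?thesis .
  qed
  show "emeasure lborel ?A \<le> ennreal (pi * \<epsilon>) * indicator {..<\<epsilon>} u"
  proof (cases "u < \<epsilon>")
    case True
    show ?thesis
    proof (cases "u \<le> 0")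
      case True
      then show ?thesis using assms by (simp add: eq)
    next
      case False
      then have "?A \<subseteq> ball 0 (sqrt \<epsilon>)" unfolding ball by auto
      then have "emeasure lborel ?A \<le> emeasure lborel (ball 0 (sqrt \<epsilon>) :: (real^2) set)"
        by (rule emeasure_mono) simp
      then show ?thesis using True assms by (simp add: area)
    qed
  next
    case False
    then have "\<not> u + y \<bullet> y < \<epsilon>" for y :: "real^2" using inner_ge_zero[of y] by linarith
    then show ?thesis by simp
  qed
qed

text \<open>Tonelli's theorem: integrate the areas of the planar fibres over
  \<open>x\<close>.\<close>

lemma emeasure_layer_bounds:
  fixes f :: "'a::euclidean_space \<Rightarrow> real"
  assumes f: "continuous_on UNIV f" and \<epsilon>: "\<epsilon> > 0"
  shows "ennreal (pi * \<epsilon>) * emeasure lborel {x. f x \<le> 0}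
      \<le> emeasure lborel {(x, y::real^2). 0 < f x + y \<bullet> y \<and> f x + y \<bullet> y < \<epsilon>}"
    and "emeasure lborel {(x, y::real^2). 0 < f x + y \<bullet> y \<and> f x + y \<bullet> y < \<epsilon>}
      \<le> ennreal (pi * \<epsilon>) * emeasure lborel {x. f x < \<epsilon>}"
proof -
  let ?A = "\<lambda>u. {y::real^2. 0 < u + y \<bullet> y \<and> u + y \<bullet> y < \<epsilon>}"
  let ?L = "{(x, y::real^2). 0 < f x + y \<bullet> y \<and> f x + y \<bullet> y < \<epsilon>}"
  have [measurable]: "f \<in> borel_measurable borel"
    using f by (rule borel_measurable_continuous_onI)
  have "open ?L"
    unfolding case_prod_beta
    by (intro open_Collect_conj open_Collect_less continuous_intros continuous_on_compose2[OF f]) auto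
  then have "?L \<in> sets (lborel \<Otimes>\<^sub>M lborel)" unfolding lborel_prod by simp
  then have "emeasure (lborel \<Otimes>\<^sub>M lborel) ?L = (\<integral>\<^sup>+x. emeasure lborel (?A (f x)) \<partial>lborel)"
    by (subst lborel.emeasure_pair_measure_alt) (auto simp: vimage_def)
  then have L: "emeasure lborel ?L = (\<integral>\<^sup>+x. emeasure lborel (?A (f x)) \<partial>lborel)"
    by (simp add: lborel_prod)
  have "ennreal (pi * \<epsilon>) * emeasure lborel {x. f x \<le> 0}
      = (\<integral>\<^sup>+x. ennreal (pi * \<epsilon>) * indicator {x. f x \<le> 0} x \<partial>lborel)"
    by (subst nn_integral_cmult_indicator) auto
  also have "\<dots> \<le> emeasure lborel ?L"
    unfolding L by (intro nn_integral_mono) (auto simp: emeasure_annulus_le(2)[OF \<epsilon>] split: split_indicator)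
  finally show "ennreal (pi * \<epsilon>) * emeasure lborel {x. f x \<le> 0} \<le> emeasure lborel ?L" .
  have "emeasure lborel ?L \<le> (\<integral>\<^sup>+x. ennreal (pi * \<epsilon>) * indicator {x. f x < \<epsilon>} x \<partial>lborel)"
    unfolding L using emeasure_annulus_le(1)[OF \<epsilon>]
    by (intro nn_integral_mono) (auto simp: indicator_def)
  also have "\<dots> = ennreal (pi * \<epsilon>) * emeasure lborel {x. f x < \<epsilon>}"
    by (subst nn_integral_cmult_indicator) auto
  finally show "emeasure lborel ?L \<le> ennreal (pi * \<epsilon>) * emeasure lborel {x. f x < \<epsilon>}" .
qed

text \<open>Continuity of measure from above along decreasing sets; boundedness supplies the finite
  measure this requires.\<close>

lemma tendsto_emeasure_sublevel:
  fixes f :: "'a::euclidean_space \<Rightarrow> real"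
  assumes f: "continuous_on UNIV f" and bdd: "bounded {x. f x \<le> 1}"
  shows "(\<lambda>k. emeasure lborel {x. f x < 1 / Suc k}) \<longlonglongrightarrow> emeasure lborel {x. f x \<le> 0}"
proof -
  have [measurable]: "f \<in> borel_measurable borel"
    using f by (rule borel_measurable_continuous_onI)
  have le1: "1 / real (Suc k) \<le> 1" for k by simp
  have "(\<Inter>k. {x. f x < 1 / Suc k}) = {x. f x \<le> 0}"
  proof (intro equalityI subsetI)
    fix x assume x: "x \<in> (\<Inter>k. {x. f x < 1 / Suc k})"
    have "(\<lambda>k. 1 / real (Suc k)) \<longlonglongrightarrow> 0" by (rule LIMSEQ_Suc[OF lim_const_over_n])
    then have "f x \<le> 0" by (rule LIMSEQ_le_const) (use x in \<open>auto intro: less_imp_le\<close>)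
    then show "x \<in> {x. f x \<le> 0}" by simp
  next
    fix x assume "x \<in> {x. f x \<le> 0}"
    then show "x \<in> (\<Inter>k. {x. f x < 1 / Suc k})"
      by (auto intro: le_less_trans)
  qed
  moreover have "(\<lambda>k. emeasure lborel {x. f x < 1 / Suc k}) \<longlonglongrightarrow> emeasure lborel (\<Inter>k. {x. f x < 1 / Suc k})"
  proof (rule Lim_emeasure_decseq)
    show "decseq (\<lambda>k. {x. f x < 1 / Suc k})"
      by (intro decseq_SucI subsetI) (auto elim!: less_le_trans intro!: divide_left_mono)
    fix k
    have "bounded {x. f x < 1 / Suc k}"
      by (rule bounded_subset[OF bdd]) (use order_trans[OF less_imp_le le1[of k]] in blast)
    then show "emeasure lborel {x. f x < 1 / Suc k} \<noteq> \<infinity>"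
      using emeasure_bounded_finite by fastforce
  qed auto
  ultimately show ?thesis by simp
qed

text \<open>The layer of \<open>f\<close> bounds \<open>pi * \<epsilon>\<close> times the left side
  from above, and the layer of \<open>g\<close> is at most \<open>pi * \<epsilon>\<close> times the
  volume of \<open>{x. g x < \<epsilon>}\<close>. The factor cancels and
  \<open>\<epsilon> = 1 / Suc k\<close> tends to 0.\<close>

lemma emeasure_sublevel_le:
  fixes f g :: "'a::euclidean_space \<Rightarrow> real"
  assumes f: "continuous_on UNIV f" and g: "continuous_on UNIV g" and bdd: "bounded {x. g x \<le> 1}"
    and le: "\<And>\<epsilon>. \<epsilon> > 0 \<Longrightarrow>
      emeasure lborel {(x, y::real^2). 0 < f x + y \<bullet> y \<and> f x + y \<bullet> y < \<epsilon>}
      \<le> emeasure lborel {(x, y::real^2). 0 < g x + y \<bullet> y \<and> g x + y \<bullet> y < \<epsilon>}"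
  shows "emeasure lborel {x. f x \<le> 0} \<le> emeasure lborel {x. g x \<le> 0}"
proof (rule LIMSEQ_le_const[OF tendsto_emeasure_sublevel[OF g bdd]], intro exI allI impI)
  fix k :: nat
  let ?\<epsilon> = "1 / real (Suc k)"
  have \<epsilon>: "?\<epsilon> > 0" by simp
  have "ennreal (pi * ?\<epsilon>) * emeasure lborel {x. f x \<le> 0} \<le> ennreal (pi * ?\<epsilon>) * emeasure lborel {x. g x < ?\<epsilon>}"
    using emeasure_layer_bounds(1)[OF f \<epsilon>] le[OF \<epsilon>] emeasure_layer_bounds(2)[OF g \<epsilon>]
    by (meson order_trans)
  moreover have "ennreal (pi * ?\<epsilon>) > 0" by simp
  ultimately show "emeasure lborel {x. f x \<le> 0} \<le> emeasure lborel {x. g x < ?\<epsilon>}"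
    by (subst (asm) ennreal_mult_le_mult_iff) auto
qed

section \<open>Unions and intersections of balls as sublevel sets\<close>

text \<open>Nonnegative radii allow squaring, so each ball is where its power distance is
  nonpositive. Some power distance is nonpositive iff the minimum is, and all are iff the maximum
  is.\<close>

lemma Union_Inter_cball_eq_ext_power:
  assumes "finite I" "I \<noteq> {}" "\<And>i. i \<in> I \<Longrightarrow> r i \<ge> 0"
  shows "(\<Union>i\<in>I. cball (c i) (r i)) = {x. ext_power 1 I c (\<lambda>i. (r i)\<^sup>2) x \<le> 0}"
    and "(\<Inter>i\<in>I. cball (c i) (r i)) = {x. ext_power (-1) I c (\<lambda>i. (r i)\<^sup>2) x \<le> 0}"
proof -
  have *: "x \<in> cball (c i) (r i) \<longleftrightarrow> power_dist (c i) ((r i)\<^sup>2) x \<le> 0" if "i \<in> I" for i x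
    using assms(3)[OF that] abs_le_square_iff[of "norm (x - c i)" "r i"]
    by (simp add: power_dist_def power2_norm_eq_inner dist_norm norm_minus_commute)
  show "(\<Union>i\<in>I. cball (c i) (r i)) = {x. ext_power 1 I c (\<lambda>i. (r i)\<^sup>2) x \<le> 0}"
    using assms(1,2) * by (auto simp: ext_power_def Min_le_iff)
  show "(\<Inter>i\<in>I. cball (c i) (r i)) = {x. ext_power (-1) I c (\<lambda>i. (r i)\<^sup>2) x \<le> 0}"
    using assms(1,2) * by (auto simp: ext_power_def)
qed

text \<open>Seen in the product space, \<open>L c\<close> is the layer of the configuration with
  zero extra coordinates. Being bounded it has finite volume, so the real inequality transfers to
  extended values.\<close>

lemma emeasure_layer_mono_expansion:
  fixes p q :: "nat \<Rightarrow> 'a::euclidean_space" and \<rho> :: "nat \<Rightarrow> real"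
  assumes "piecewise_smooth_expansion N (\<lambda>i. (p i, 0 :: real^2)) (\<lambda>i. (q i, 0 :: real^2))"
    and N: "N \<ge> 1" and \<sigma>: "\<sigma> = 1 \<or> \<sigma> = -1" and \<epsilon>: "\<epsilon> > 0"
  defines "L \<equiv> \<lambda>c. {(x, y::real^2). 0 < ext_power \<sigma> {1..N} c \<rho> x + y \<bullet> y \<and>
    ext_power \<sigma> {1..N} c \<rho> x + y \<bullet> y < \<epsilon>}"
  shows "\<sigma> = 1 \<Longrightarrow> emeasure lborel (L p) \<le> emeasure lborel (L q)"
    and "\<sigma> = -1 \<Longrightarrow> emeasure lborel (L q) \<le> emeasure lborel (L p)"
proof -
  have I: "finite {1..N}" "{1..N} \<noteq> {}" using N by auto
  have L: "L c = {z. 0 < ext_power \<sigma> {1..N} (\<lambda>i. (c i, 0)) \<rho> z \<and>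
      ext_power \<sigma> {1..N} (\<lambda>i. (c i, 0)) \<rho> z < \<epsilon>}" for c
    unfolding L_def ext_power_Pair_0[OF I \<sigma>, symmetric] by auto
  have "bounded (L c)" for c
    unfolding L
    by (rule bounded_subset[OF bounded_ext_power_le[OF I \<sigma>, of "\<lambda>i. (c i, 0)" \<rho> \<epsilon>]]) auto
  then have "emeasure lborel (L c) = ennreal (measure lborel (L c))" for c
    using emeasure_bounded_finite[of "L c"] by (intro emeasure_eq_ennreal_measure) auto
  moreover have "\<sigma> * measure lborel (L p) \<le> \<sigma> * measure lborel (L q)"
    unfolding L by (rule measure_layer_mono_expansion[OF assms(1) N \<sigma> \<epsilon>])
  ultimately show "\<sigma> = 1 \<Longrightarrow> emeasure lborel (L p) \<le> emeasure lborel (L q)"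
    "\<sigma> = -1 \<Longrightarrow> emeasure lborel (L q) \<le> emeasure lborel (L p)"
    by (auto intro!: ennreal_leI)
qed

theorem theorem1:
  fixes N :: nat and p q :: "nat \<Rightarrow> real ^ 'n" and r :: "nat \<Rightarrow> real"
  assumes "piecewise_smooth_expansion N
             (\<lambda>i. (p i, 0 :: real ^ 2)) (\<lambda>i. (q i, 0 :: real ^ 2))"
    and "\<forall>i\<in>{1..N}. r i \<ge> 0"
  shows "emeasure lborel (\<Union>i\<in>{1..N}. cball (p i) (r i))
           \<le> emeasure lborel (\<Union>i\<in>{1..N}. cball (q i) (r i))
       \<and> emeasure lborel (\<Inter>i\<in>{1..N}. cball (p i) (r i))
           \<ge> emeasure lborel (\<Inter>i\<in>{1..N}. cball (q i) (r i))"
proof (cases "N = 0")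
  case False
  then have N: "N \<ge> 1" by simp
  then have I: "finite {1..N}" "{1..N} \<noteq> {}" by auto
  have r: "r i \<ge> 0" if "i \<in> {1..N}" for i using assms(2) that by blast
  have sign: "(1::real) = 1 \<or> (1::real) = -1" "(-1::real) = 1 \<or> (-1::real) = -1" by auto
  note mono = emeasure_layer_mono_expansion[OF assms(1) N]
  have eq: "(\<Union>i\<in>{1..N}. cball (c i) (r i)) = {x. ext_power 1 {1..N} c (\<lambda>i. (r i)\<^sup>2) x \<le> 0}"
    "(\<Inter>i\<in>{1..N}. cball (c i) (r i)) = {x. ext_power (-1) {1..N} c (\<lambda>i. (r i)\<^sup>2) x \<le> 0}"
    for c :: "nat \<Rightarrow> real ^ 'n"
    using I r by (intro Union_Inter_cball_eq_ext_power; blast)+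
  \<comment> \<open>For the intersections the sign \<open>-1\<close> reverses the comparison of
    layers, so the sublevel comparison is used with \<open>q\<close> on the smaller side.\<close>
  show ?thesis
    unfolding eq
    by (intro conjI emeasure_sublevel_le continuous_ext_power bounded_ext_power_le I sign
        mono(1)[OF sign(1)] mono(2)[OF sign(2)] refl)
\<comment> \<open>For \<open>N = 0\<close> both unions are empty and both intersections are the
  whole space.\<close>
qed simp

end
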